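(* Let $A>0$ be a real number and let $F:\mathbb{BC}\to\mathbb{BC}$ be a bicomplex entire function of exponential type, i.e. there is a (hyperbolic) constant $C<\infty$ such that $$\|F(Z)\|_k\le C\exp\{A\|Z\|_k\}\qquad\text{for all } Z\in\mathbb{BC}.$$ Suppose that $$\int_{(-\infty,\infty)_{\mathbb{D}}}\|F(x_0+kx_3)\|_k^2\,dx_0\odot dx_0^\dagger<\infty .$$ Then there exists $\mathfrak{F}\in L_k^2(-A,A)_{\mathbb{D}}$ such that $$F(Z)=\int_{(-A,A)_{\mathbb{D}}}\mathfrak{F}(t)\exp\{itZ\}\,dt\odot dt^\dagger\qquad\text{for all } Z\in\mathbb{BC}.$$
   Context: Bicomplex numbers: $\mathbb{BC}=\{z_1+jz_2: z_1,z_2\in\mathbb{C}\}$, where $\mathbb{C}=\mathbb{C}(i)$, $i^2=j^2=-1$, $ij=ji=k$, $k^2=1$ (a commutative ring). Put $e=\frac{1+ij}{2}$, $e^\dagger=\frac{1-ij}{2}$; these are idempotents with $e e^\dagger=0$, $e+e^\dagger=1$. Every $Z=z_1+jz_2$ is uniquely $Z=e\beta_1+e^\dagger\beta_2$ with $\beta_1=z_1-iz_2$, $\beta_2=z_1+iz_2\in\mathbb{C}$; algebraic operations and $\exp$ act componentwise. Hyperbolic numbers: $\mathbb{D}=\{a+kb:a,b\in\mathbb{R}\}=\{e s_1+e^\dagger s_2: s_1,s_2\in\mathbb{R}\}$, with $x_0+kx_3=e(x_0+x_3)+e^\dagger(x_0-x_3)$. Inequalities and finiteness in $\mathbb{D}$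 are componentwise with respect to $e,e^\dagger$. The hyperbolic norm is $\|e\beta_1+e^\dagger\beta_2\|_k=e|\beta_1|+e^\dagger|\beta_2|\in\mathbb{D}$. A function $F:\mathbb{BC}\to\mathbb{BC}$ is bicomplex entire (holomorphic on $\mathbb{BC}$) if and only if $F(e\beta_1+e^\dagger\beta_2)=eF_1(\beta_1)+e^\dagger F_2(\beta_2)$ with $F_1,F_2:\mathbb{C}\to\mathbb{C}$ entire. Intervals and integrals: for $-\infty\le a<b\le\infty$, $(a,b)_{\mathbb{D}}=e(a,b)+e^\dagger(a,b)$. For a product-type function $G(es_1+e^\dagger s_2)=eG_1(s_1)+e^\dagger G_2(s_2)$, the $\mathbb{D}$-integral is $\int_{(a,b)_{\mathbb{D}}}G(t)\,dt\odot dt^\dagger=e\int_a^bG_1(s)\,ds+e^\dagger\int_a^bG_2(s)\,ds$. In particular $\int_{(-\infty,\infty)_{\mathbb{D}}}\|F(x_0+kx_3)\|_k^2dx_0\odot dx_0^\dagger=e\int_{-\infty}^\infty|F_1(s)|^2ds+e^\dagger\int_{-\infty}^\infty|F_2(s)|^2ds$, and $\int_{(-A,A)_{\mathbb{D}}}\mathfrak{F}(t)\exp\{itZ\}\,dt\odot dt^\dagger=e\int_{-A}^A\mathfrak{F}_1(t)e^{it\beta_1}dt+e^\dagger\int_{-A}^A\mathfrak{F}_2(t)e^{it\beta_2}dt$. $L_k^2(-A,A)_{\mathbb{D}}=eL^2(-A,A)+e^\dagger L^2(-A,A)$ (product-type functions $\mathfrak F=e\mathfrak{F}_1+e^\dagger\mathfrak{F}_2$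 with $\mathfrak{F}_1,\mathfrak{F}_2\in L^2(-A,A)$ for Lebesgue measure). *)

theory Defs
  imports "HOL-Analysis.Analysis"
begin

section \<open>The ring of bicomplex numbers\<close>

text \<open>
  \<open>Bicomplex z1 z2\<close> is the bicomplex number \<open>z1 + j z2\<close>.
\<close>

codatatype bicomplex = Bicomplex (bc_fst: complex) (bc_snd: complex)

lemma bicomplex_eqI [intro?]: "bc_fst X = bc_fst Y \<Longrightarrow> bc_snd X = bc_snd Y \<Longrightarrow> X = Y"
  by (rule bicomplex.expand) simp

lemma bicomplex_eq_iff: "X = Y \<longleftrightarrow> bc_fst X = bc_fst Y \<and> bc_snd X = bc_snd Y"
  by (auto intro: bicomplex.expand)

instantiation bicomplex :: comm_ring_1
begin

primcorec zero_bicomplex where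
  "bc_fst 0 = 0" | "bc_snd 0 = 0"

primcorec one_bicomplex where
  "bc_fst 1 = 1" | "bc_snd 1 = 0"

primcorec plus_bicomplex where
  "bc_fst (X + Y) = bc_fst X + bc_fst Y" | "bc_snd (X + Y) = bc_snd X + bc_snd Y"

primcorec uminus_bicomplex where
  "bc_fst (- X) = - bc_fst X" | "bc_snd (- X) = - bc_snd X"

primcorec minus_bicomplex where
  "bc_fst (X - Y) = bc_fst X - bc_fst Y" | "bc_snd (X - Y) = bc_snd X - bc_snd Y"

primcorec times_bicomplex where
  "bc_fst (X * Y) = bc_fst X * bc_fst Y - bc_snd X * bc_snd Y"
| "bc_snd (X * Y) = bc_fst X * bc_snd Y + bc_snd X * bc_fst Y"

instance
  by standard (simp_all add: bicomplex_eq_iff algebra_simps)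

end

text \<open>
  The inverse of \<open>z1 + j z2\<close> is \<open>(z1 - j z2) / (z1\<^sup>2 + z2\<^sup>2)\<close>.  It is only meaningful for
  invertible numbers, see \<open>bc_inverse_right\<close>; for zero divisors the value is \<open>0\<close>.
\<close>

instantiation bicomplex :: inverse
begin

primcorec inverse_bicomplex where
  "bc_fst (inverse X) = bc_fst X / ((bc_fst X)\<^sup>2 + (bc_snd X)\<^sup>2)"
| "bc_snd (inverse X) = - bc_snd X / ((bc_fst X)\<^sup>2 + (bc_snd X)\<^sup>2)"

definition "X div Y = X * inverse Y" for X Y :: bicomplex

instance ..

end

instantiation bicomplex :: real_algebra_1
begin

primcorec scaleR_bicomplex where
  "bc_fst (scaleR r X) = scaleR r (bc_fst X)" | "bc_snd (scaleR r X) = scaleR r (bc_snd X)"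

instance
  by standard (simp_all add: bicomplex_eq_iff algebra_simps)

end

text \<open>
  The Euclidean norm, which serves only to provide the topology of \<open>\<complex>\<^sup>2\<close>.
\<close>

instantiation bicomplex :: real_normed_vector
begin

definition norm_bicomplex_def:
  "norm X = norm (bc_fst X, bc_snd X)" for X :: bicomplex

definition sgn_bicomplex_def:
  "sgn X = X /\<^sub>R norm X" for X :: bicomplex

definition dist_bicomplex_def:
  "dist X Y = norm (X - Y)" for X Y :: bicomplex

definition uniformity_bicomplex_def [code del]:
  "(uniformity :: (bicomplex \<times> bicomplex) filter) = (INF e\<in>{0 <..}. principal {(X, Y). dist X Y < e})"

definition open_bicomplex_def [code del]:
  "open (U :: bicomplex set) \<longleftrightarrow> (\<forall>X\<in>U. eventually (\<lambda>(X', Y). X' = X \<longrightarrow> Y \<in> U) uniformity)"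

instance
proof
  fix X Y :: bicomplex and r :: real
  show "norm X = 0 \<longleftrightarrow> X = 0"
    by (simp add: norm_bicomplex_def bicomplex_eq_iff zero_prod_def)
  show "norm (X + Y) \<le> norm X + norm Y"
    using norm_triangle_ineq[of "(bc_fst X, bc_snd X)" "(bc_fst Y, bc_snd Y)"]
    by (simp add: norm_bicomplex_def)
  show "norm (r *\<^sub>R X) = \<bar>r\<bar> * norm X"
    using norm_scaleR[of r "(bc_fst X, bc_snd X)"]
    by (simp only: norm_bicomplex_def scaleR_bicomplex.sel scaleR_Pair)
qed (rule sgn_bicomplex_def dist_bicomplex_def uniformity_bicomplex_def open_bicomplex_def)+

end

definition bc_of_complex :: "complex \<Rightarrow> bicomplex" where
  "bc_of_complex z = Bicomplex z 0"

definition bc_i :: bicomplex where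
  "bc_i = bc_of_complex \<i>"

definition bc_j :: bicomplex where
  "bc_j = Bicomplex 0 1"

lemma bc_units_mult:
  "bc_i * bc_i = -1" "bc_j * bc_j = -1" "(bc_i * bc_j) * (bc_i * bc_j) = 1"
  by (simp_all add: bicomplex_eq_iff bc_i_def bc_j_def bc_of_complex_def)

lemma Bicomplex_eq: "Bicomplex z1 z2 = bc_of_complex z1 + bc_j * bc_of_complex z2"
  by (simp add: bicomplex_eq_iff bc_j_def bc_of_complex_def)


section \<open>The idempotent representation\<close>

definition bc_e :: bicomplex where
  "bc_e = (1 + bc_i * bc_j) /\<^sub>R 2"

definition bc_e_dag :: bicomplex where
  "bc_e_dag = (1 - bc_i * bc_j) /\<^sub>R 2"

definition idem_comb :: "complex \<Rightarrow> complex \<Rightarrow> bicomplex" where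
  "idem_comb \<beta>1 \<beta>2 = bc_e * bc_of_complex \<beta>1 + bc_e_dag * bc_of_complex \<beta>2"

definition idem1 :: "bicomplex \<Rightarrow> complex" where
  "idem1 Z = bc_fst Z - \<i> * bc_snd Z"

definition idem2 :: "bicomplex \<Rightarrow> complex" where
  "idem2 Z = bc_fst Z + \<i> * bc_snd Z"

lemma bc_e_eq: "bc_e = Bicomplex (1 / 2) (\<i> / 2)" "bc_e_dag = Bicomplex (1 / 2) (- \<i> / 2)"
  by (simp_all add: bicomplex_eq_iff bc_e_def bc_e_dag_def bc_i_def bc_j_def bc_of_complex_def
      scaleR_conv_of_real[where 'a = complex])

lemma bc_e_mult:
  "bc_e * bc_e = bc_e" "bc_e_dag * bc_e_dag = bc_e_dag" "bc_e * bc_e_dag = 0" "bc_e + bc_e_dag = 1"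
  by (simp_all add: bicomplex_eq_iff bc_e_eq)

lemma idem_comb_eq: "idem_comb a b = Bicomplex ((a + b) / 2) (\<i> * (a - b) / 2)"
  by (simp add: bicomplex_eq_iff idem_comb_def bc_e_eq bc_of_complex_def field_simps)

lemma idem_comb_sel [simp]: "idem1 (idem_comb a b) = a" "idem2 (idem_comb a b) = b"
  by (simp_all add: idem_comb_eq idem1_def idem2_def field_simps)

lemma idem_comb_collapse [simp]: "idem_comb (idem1 Z) (idem2 Z) = Z"
  by (simp add: bicomplex_eq_iff idem_comb_eq idem1_def idem2_def field_simps)

lemma idem_eqI: "idem1 X = idem1 Y \<Longrightarrow> idem2 X = idem2 Y \<Longrightarrow> X = Y"
  by (metis idem_comb_collapse)

lemma idem_simps [simp]:
  "idem1 0 = 0" "idem2 0 = 0" "idem1 1 = 1" "idem2 1 = 1"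
  "idem1 (X + Y) = idem1 X + idem1 Y" "idem2 (X + Y) = idem2 X + idem2 Y"
  "idem1 (X - Y) = idem1 X - idem1 Y" "idem2 (X - Y) = idem2 X - idem2 Y"
  "idem1 (X * Y) = idem1 X * idem1 Y" "idem2 (X * Y) = idem2 X * idem2 Y"
  "idem1 (of_real r) = of_real r" "idem2 (of_real r) = of_real r"
  "idem1 (r *\<^sub>R X) = r *\<^sub>R idem1 X" "idem2 (r *\<^sub>R X) = r *\<^sub>R idem2 X"
  "idem1 bc_i = \<i>" "idem2 bc_i = \<i>" "idem1 bc_j = - \<i>" "idem2 bc_j = \<i>"
  by (simp_all add: idem1_def idem2_def bc_i_def bc_j_def bc_of_complex_def of_real_def algebra_simps)

lemma idem_power [simp]: "idem1 (X ^ n) = idem1 X ^ n" "idem2 (X ^ n) = idem2 X ^ n"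
  by (induction n) simp_all

lemma bc_unit_iff: "(H :: bicomplex) dvd 1 \<longleftrightarrow> idem1 H \<noteq> 0 \<and> idem2 H \<noteq> 0"
proof
  assume "H dvd 1"
  then obtain K where "1 = H * K" by (rule dvdE)
  then have "idem1 H * idem1 K = 1" "idem2 H * idem2 K = 1"
    by (metis idem_simps(3,9), metis idem_simps(4,10))
  then show "idem1 H \<noteq> 0 \<and> idem2 H \<noteq> 0" by auto
next
  assume "idem1 H \<noteq> 0 \<and> idem2 H \<noteq> 0"
  then have "1 = H * idem_comb (1 / idem1 H) (1 / idem2 H)" by (intro idem_eqI) auto
  then show "H dvd 1" by (rule dvdI)
qed

lemma bc_inverse_right:
  fixes H :: bicomplex
  assumes "H dvd 1" shows "H * inverse H = 1"
proof -
  have "idem1 H * idem2 H = (bc_fst H)\<^sup>2 + (bc_snd H)\<^sup>2"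
    by (simp add: idem1_def idem2_def algebra_simps power2_eq_square)
  with assms have "(bc_fst H)\<^sup>2 + (bc_snd H)\<^sup>2 \<noteq> 0"
    by (metis bc_unit_iff mult_eq_0_iff)
  then show ?thesis
    by (simp add: bicomplex_eq_iff flip: add_divide_distrib) (simp add: power2_eq_square)
qed

lemma idem_divide:
  fixes H :: bicomplex
  assumes "H dvd 1"
  shows "idem1 (X / H) = idem1 X / idem1 H" "idem2 (X / H) = idem2 X / idem2 H"
proof -
  have "idem1 H * idem1 (inverse H) = 1" "idem2 H * idem2 (inverse H) = 1"
    using bc_inverse_right[OF assms] by (metis idem_simps(3,9), metis idem_simps(4,10))
  then have "idem1 (inverse H) = 1 / idem1 H" "idem2 (inverse H) = 1 / idem2 H"
    by (metis assms bc_unit_iff nonzero_eq_divide_eq mult.commute)+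
  then show "idem1 (X / H) = idem1 X / idem1 H" "idem2 (X / H) = idem2 X / idem2 H"
    by (simp_all add: divide_bicomplex_def)
qed

definition bc_exp :: "bicomplex \<Rightarrow> bicomplex" where
  "bc_exp Z = idem_comb (exp (idem1 Z)) (exp (idem2 Z))"


section \<open>Bicomplex entire functions\<close>

text \<open>
  The difference quotient only makes sense for increments that are not zero divisors.
  Lemma \<open>bc_entire_iff\<close> is the characterization by the idempotent components.
\<close>

definition bc_has_derivative :: "(bicomplex \<Rightarrow> bicomplex) \<Rightarrow> bicomplex \<Rightarrow> bicomplex \<Rightarrow> bool" where
  "bc_has_derivative F D Z \<longleftrightarrow>
     ((\<lambda>H. (F (Z + H) - F Z) / H) \<longlongrightarrow> D) (at 0 within {H. H dvd 1})"

definition bc_entire :: "(bicomplex \<Rightarrow> bicomplex) \<Rightarrow> bool" where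
  "bc_entire F \<longleftrightarrow> (\<forall>Z. \<exists>D. bc_has_derivative F D Z)"

lemma bounded_linear_bc_fst: "bounded_linear bc_fst"
  by (rule bounded_linear_intro[where K = 1])
     (use norm_fst_le in \<open>auto simp: norm_bicomplex_def\<close>)

lemma bounded_linear_bc_snd: "bounded_linear bc_snd"
  by (rule bounded_linear_intro[where K = 1])
     (use norm_snd_le in \<open>auto simp: norm_bicomplex_def\<close>)

lemma bounded_linear_idem1: "bounded_linear idem1"
  unfolding idem1_def
  by (intro bounded_linear_sub bounded_linear_bc_fst
        bounded_linear_compose[OF bounded_linear_mult_right bounded_linear_bc_snd])

lemma bounded_linear_idem2: "bounded_linear idem2"
  unfolding idem2_def
  by (intro bounded_linear_add bounded_linear_bc_fst
        bounded_linear_compose[OF bounded_linear_mult_right bounded_linear_bc_snd])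

lemma norm_idem_comb_le: "norm (idem_comb a b) \<le> norm a + norm b"
proof -
  have "norm (idem_comb a b) \<le> norm ((a + b) / 2) + norm (\<i> * (a - b) / 2)"
    unfolding norm_bicomplex_def idem_comb_eq bicomplex.sel by (rule norm_Pair_le)
  also have "\<dots> = norm (a + b) / 2 + norm (a - b) / 2"
    by (simp add: norm_divide norm_mult)
  also have "\<dots> \<le> norm a + norm b"
    using norm_triangle_ineq[of a b] norm_triangle_ineq4[of a b] by simp
  finally show ?thesis .
qed

lemma idem_comb_add: "idem_comb (a + c) (b + d) = idem_comb a b + idem_comb c d"
  by (intro idem_eqI) auto

lemma tendsto_idem_comb:
  assumes "(f \<longlongrightarrow> a) G" "(g \<longlongrightarrow> b) G"
  shows "((\<lambda>x. idem_comb (f x) (g x)) \<longlongrightarrow> idem_comb a b) G"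
proof (rule Lim_null[THEN iffD2], rule Lim_null_comparison)
  show "\<forall>\<^sub>F x in G. norm (idem_comb (f x) (g x) - idem_comb a b) \<le> norm (f x - a) + norm (g x - b)"
  proof (intro always_eventually allI)
    fix x
    have "idem_comb (f x) (g x) - idem_comb a b = idem_comb (f x - a) (g x - b)"
      by (intro idem_eqI) auto
    then show "norm (idem_comb (f x) (g x) - idem_comb a b) \<le> norm (f x - a) + norm (g x - b)"
      by (simp add: norm_idem_comb_le)
  qed
  show "((\<lambda>x. norm (f x - a) + norm (g x - b)) \<longlongrightarrow> 0) G"
    using assms by (auto intro!: tendsto_add_zero tendsto_norm_zero simp: Lim_null[symmetric])
qed

lemma bc_has_derivative_iff:
  "bc_has_derivative F D Z \<longleftrightarrow>
     ((\<lambda>H. (idem1 (F (Z + H)) - idem1 (F Z)) / idem1 H) \<longlongrightarrow> idem1 D) (at 0 within {H. H dvd 1}) \<and>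
     ((\<lambda>H. (idem2 (F (Z + H)) - idem2 (F Z)) / idem2 H) \<longlongrightarrow> idem2 D) (at 0 within {H. H dvd 1})"
  (is "?L \<longleftrightarrow> ?R1 \<and> ?R2")
proof -
  let ?G = "at 0 within {H :: bicomplex. H dvd 1}"
  let ?Q = "\<lambda>H. (F (Z + H) - F Z) / H"
  have ev: "\<forall>\<^sub>F H in ?G. H dvd 1" by (auto simp: eventually_at_filter)
  have 1: "?R1 \<longleftrightarrow> ((\<lambda>H. idem1 (?Q H)) \<longlongrightarrow> idem1 D) ?G"
    by (rule tendsto_cong, use ev in eventually_elim) (simp add: idem_divide)
  have 2: "?R2 \<longleftrightarrow> ((\<lambda>H. idem2 (?Q H)) \<longlongrightarrow> idem2 D) ?G"
    by (rule tendsto_cong, use ev in eventually_elim) (simp add: idem_divide)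
  show ?thesis
    unfolding 1 2 bc_has_derivative_def
    using bounded_linear.tendsto[OF bounded_linear_idem1, of ?Q D ?G]
      bounded_linear.tendsto[OF bounded_linear_idem2, of ?Q D ?G]
      tendsto_idem_comb[of "\<lambda>H. idem1 (?Q H)" "idem1 D" ?G "\<lambda>H. idem2 (?Q H)" "idem2 D"]
    by auto
qed

lemma quotient_limit_local_bound:
  fixes Z :: bicomplex and D :: complex
  assumes "((\<lambda>H. (f (Z + H) - f Z) / g H) \<longlongrightarrow> D) (at 0 within {H. H dvd 1})"
  obtains \<delta> C where "\<delta> > 0" "C \<ge> 0"
    "\<And>H. H dvd 1 \<Longrightarrow> norm H < \<delta> \<Longrightarrow> norm ((f (Z + H) - f Z) / g H :: complex) \<le> C"
proof -
  have "\<forall>\<^sub>F H in at 0 within {H. H dvd 1}. dist ((f (Z + H) - f Z) / g H) D < 1"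
    by (rule tendstoD[OF assms]) simp
  then obtain \<delta> where d: "\<delta> > 0" "\<And>H. H dvd 1 \<Longrightarrow> H \<noteq> 0 \<Longrightarrow> norm H < \<delta> \<Longrightarrow>
      dist ((f (Z + H) - f Z) / g H) D < 1"
    unfolding eventually_at by auto
  show ?thesis
  proof (rule that[of \<delta> "norm D + 1"])
    fix H :: bicomplex assume H: "H dvd 1" "norm H < \<delta>"
    then have "H \<noteq> 0" by (auto simp: bc_unit_iff)
    from d(2)[OF H(1) this H(2)] have "norm ((f (Z + H) - f Z) / g H - D) < 1"
      by (simp add: dist_norm)
    then show "norm ((f (Z + H) - f Z) / g H) \<le> norm D + 1"
      using norm_triangle_sub[of "(f (Z + H) - f Z) / g H" D] by linarith
  qed (use d in auto)
qed

text \<open>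
  A component of a function with bicomplex derivatives does not depend on the other variable:
  \<open>C\<close> stands for \<open>idem_comb\<close> with either order of arguments.
\<close>

lemma component_independent:
  fixes f :: "bicomplex \<Rightarrow> complex" and C :: "complex \<Rightarrow> complex \<Rightarrow> bicomplex"
  assumes C: "C = idem_comb \<and> p = idem1 \<or> C = (\<lambda>a b. idem_comb b a) \<and> p = idem2"
    and lim: "\<And>Z. \<exists>D. ((\<lambda>H. (f (Z + H) - f Z) / p H) \<longlongrightarrow> D) (at 0 within {H. H dvd 1})"
  shows "f (C a b) = f (C a b')"
proof -
  have Cadd: "C (x + u) (y + v) = C x y + C u v" for x y u v
    using C by (auto simp: idem_comb_add)
  have Cunit: "C u v dvd 1 \<longleftrightarrow> u \<noteq> 0 \<and> v \<noteq> 0" for u v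
    using C by (auto simp: bc_unit_iff)
  have Cnorm: "norm (C u v) \<le> norm u + norm v" for u v
    using C norm_idem_comb_le[of u v] norm_idem_comb_le[of v u] by auto
  have Cp: "p (C u v) = u" for u v
    using C by auto
  have bound: "\<exists>\<delta>>0. \<exists>K\<ge>0. \<forall>u v. u \<noteq> 0 \<longrightarrow> v \<noteq> 0 \<longrightarrow> norm u + norm v < \<delta> \<longrightarrow>
      norm (f (C (x + u) (y + v)) - f (C x y)) \<le> K * norm u" for x y
  proof -
    obtain D where "((\<lambda>H. (f (C x y + H) - f (C x y)) / p H) \<longlongrightarrow> D) (at 0 within {H. H dvd 1})"
      using lim by blast
    from quotient_limit_local_bound[OF this] obtain \<delta> K where dK: "\<delta> > 0" "K \<ge> 0"
      "\<And>H. H dvd 1 \<Longrightarrow> norm H < \<delta> \<Longrightarrow> norm ((f (C x y + H) - f (C x y)) / p H) \<le> K" by metis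
    have "norm (f (C (x + u) (y + v)) - f (C x y)) \<le> K * norm u"
      if "u \<noteq> 0" "v \<noteq> 0" "norm u + norm v < \<delta>" for u v
    proof -
      have "C u v dvd 1" "norm (C u v) < \<delta>"
        using that Cunit Cnorm[of u v] by auto
      from dK(3)[OF this] show ?thesis
        using that by (simp add: Cadd Cp norm_divide field_simps)
    qed
    with dK show ?thesis by blast
  qed
  have loc: "\<exists>\<delta>>0. \<forall>y'. norm (y' - y) < \<delta> \<longrightarrow> f (C a y') = f (C a y)" for y
  proof -
    from bound[of a y] obtain \<delta> K where dK: "\<delta> > 0" "K \<ge> 0"
      "\<And>u v. u \<noteq> 0 \<Longrightarrow> v \<noteq> 0 \<Longrightarrow> norm u + norm v < \<delta> \<Longrightarrow>
         norm (f (C (a + u) (y + v)) - f (C a y)) \<le> K * norm u" by metis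
    have "f (C a y') = f (C a y)" if y': "norm (y' - y) < \<delta>" "y' \<noteq> y" for y'
    proof -
      from bound[of a y'] obtain \<delta>' K' where dK': "\<delta>' > 0" "K' \<ge> 0"
        "\<And>u v. u \<noteq> 0 \<Longrightarrow> v \<noteq> 0 \<Longrightarrow> norm u + norm v < \<delta>' \<Longrightarrow>
           norm (f (C (a + u) (y' + v)) - f (C a y')) \<le> K' * norm u" by metis
      define \<eta> where "\<eta> = min (min (\<delta>' / 2) ((\<delta> - norm (y' - y)) / 2)) (norm (y' - y))"
      have \<eta>: "\<eta> > 0" using dK' y' by (auto simp: \<eta>_def)
      have *: "norm (f (C a y') - f (C a y)) \<le> (K + K') * r" if r: "0 < r" "r < \<eta>" for r
      proof -
        define u :: complex where "u = of_real r"
        have u: "norm u = r" "u \<noteq> 0" using r by (auto simp: u_def)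
        have r2: "2 * r < \<delta>'" "2 * r < \<delta> - norm (y' - y)" "r < norm (y' - y)"
          using r by (auto simp: \<eta>_def)
        have "norm (f (C (a + u) (y' + u)) - f (C a y')) \<le> K' * norm u"
          by (rule dK'(3)) (use u r2 in auto)
        moreover have "norm (f (C (a + u) (y + (y' - y + u))) - f (C a y)) \<le> K * norm u"
        proof (rule dK(3))
          show "y' - y + u \<noteq> 0"
            using u r2 by (metis add_eq_0_iff norm_minus_cancel less_irrefl)
          show "norm u + norm (y' - y + u) < \<delta>"
            using norm_triangle_ineq[of "y' - y" u] u r2 by linarith
        qed (use u in auto)
        moreover have "y + (y' - y + u) = y' + u" by simp
        ultimately show ?thesis
          using norm_triangle_ineq4[of "f (C (a + u) (y' + u)) - f (C a y)"
              "f (C (a + u) (y' + u)) - f (C a y')"] u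
          by (simp add: algebra_simps)
      qed
      have "norm (f (C a y') - f (C a y)) \<le> 0"
      proof (rule tendsto_lowerbound)
        show "((\<lambda>r. (K + K') * r) \<longlongrightarrow> 0) (at_right 0)"
          by (auto intro!: tendsto_eq_intros)
        show "\<forall>\<^sub>F r in at_right 0. norm (f (C a y') - f (C a y)) \<le> (K + K') * r"
          unfolding eventually_at_right_field using \<eta> * by blast
      qed auto
      then show ?thesis by simp
    qed
    with dK(1) show ?thesis by metis
  qed
  show ?thesis
  proof (rule connected_local_const[of UNIV b b' "\<lambda>y. f (C a y)"])
    show "\<forall>y\<in>UNIV. \<forall>\<^sub>F y' in at y within UNIV. f (C a y) = f (C a y')"
    proof
      fix y
      obtain \<delta> where \<delta>: "\<delta> > 0" "\<And>y'. norm (y' - y) < \<delta> \<Longrightarrow> f (C a y') = f (C a y)"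
        using loc by blast
      have "\<forall>y'\<in>UNIV. y' \<noteq> y \<and> dist y' y < \<delta> \<longrightarrow> f (C a y) = f (C a y')"
        unfolding dist_norm by (intro ballI impI, elim conjE, rule \<delta>(2)[symmetric])
      with \<delta>(1) show "\<forall>\<^sub>F y' in at y within UNIV. f (C a y) = f (C a y')"
        unfolding eventually_at by blast
    qed
  qed (auto intro: connected_UNIV)
qed

lemma filterlim_idem1: "filterlim idem1 (at 0) (at 0 within {H. H dvd 1})"
  unfolding filterlim_at
proof
  show "\<forall>\<^sub>F x in at 0 within {H. H dvd 1}. idem1 x \<in> UNIV \<and> idem1 x \<noteq> 0"
    by (auto simp: eventually_at_filter bc_unit_iff)
  show "(idem1 \<longlongrightarrow> 0) (at 0 within {H. H dvd 1})"
    using bounded_linear.tendsto[OF bounded_linear_idem1 tendsto_ident_at,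
        of 0 "{H. H dvd 1}"] by simp
qed

lemma filterlim_idem2: "filterlim idem2 (at 0) (at 0 within {H. H dvd 1})"
  unfolding filterlim_at
proof
  show "\<forall>\<^sub>F x in at 0 within {H. H dvd 1}. idem2 x \<in> UNIV \<and> idem2 x \<noteq> 0"
    by (auto simp: eventually_at_filter bc_unit_iff)
  show "(idem2 \<longlongrightarrow> 0) (at 0 within {H. H dvd 1})"
    using bounded_linear.tendsto[OF bounded_linear_idem2 tendsto_ident_at,
        of 0 "{H. H dvd 1}"] by simp
qed

lemma filterlim_diagonal: "filterlim (\<lambda>h. idem_comb h h) (at 0 within {H. H dvd 1}) (at 0)"
  unfolding filterlim_at
proof
  show "\<forall>\<^sub>F h in at 0. idem_comb h h \<in> {H. H dvd 1} \<and> idem_comb h h \<noteq> 0"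
  proof -
    have "idem_comb h h dvd 1 \<and> idem_comb h h \<noteq> 0" if "h \<noteq> 0" for h
      using that by (metis bc_unit_iff idem_comb_sel(1,2) idem_simps(1))
    then show ?thesis by (auto simp: eventually_at_filter)
  qed
  have "idem_comb 0 0 = 0" by (intro idem_eqI) auto
  then show "((\<lambda>h. idem_comb h h) \<longlongrightarrow> 0) (at 0)"
    using tendsto_idem_comb[OF tendsto_ident_at tendsto_ident_at, of 0 UNIV] by simp
qed

theorem bc_entire_iff:
  "bc_entire F \<longleftrightarrow>
     (\<exists>F1 F2. F1 holomorphic_on UNIV \<and> F2 holomorphic_on UNIV \<and>
        (\<forall>\<beta>1 \<beta>2. F (idem_comb \<beta>1 \<beta>2) = idem_comb (F1 \<beta>1) (F2 \<beta>2)))"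
proof
  assume entire: "bc_entire F"
  define F1 where "F1 = (\<lambda>a. idem1 (F (idem_comb a 0)))"
  define F2 where "F2 = (\<lambda>b. idem2 (F (idem_comb 0 b)))"
  have lim: "\<exists>D. ((\<lambda>H. (idem1 (F (Z + H)) - idem1 (F Z)) / idem1 H) \<longlongrightarrow> D) (at 0 within {H. H dvd 1})"
    "\<exists>D. ((\<lambda>H. (idem2 (F (Z + H)) - idem2 (F Z)) / idem2 H) \<longlongrightarrow> D) (at 0 within {H. H dvd 1})" for Z
    using entire unfolding bc_entire_def bc_has_derivative_iff by blast+
  have 1: "idem1 (F (idem_comb a b)) = F1 a" for a b
    unfolding F1_def
    using component_independent[of idem_comb idem1 "\<lambda>Z. idem1 (F Z)" a b 0] lim(1) by blast
  have 2: "idem2 (F (idem_comb a b)) = F2 b" for a b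
    unfolding F2_def
    using component_independent[of "\<lambda>a b. idem_comb b a" idem2 "\<lambda>Z. idem2 (F Z)" b a 0] lim(2)
    by blast
  have "\<exists>D. (F1 has_field_derivative D) (at a)" for a
  proof -
    from lim(1) obtain D where
      "((\<lambda>H. (idem1 (F (idem_comb a 0 + H)) - idem1 (F (idem_comb a 0))) / idem1 H) \<longlongrightarrow> D)
         (at 0 within {H. H dvd 1})" by blast
    from filterlim_compose[OF this filterlim_diagonal]
    have "((\<lambda>h. (F1 (a + h) - F1 a) / h) \<longlongrightarrow> D) (at 0)"
      by (simp add: 1 flip: idem_comb_add)
    then show ?thesis unfolding DERIV_def by blast
  qed
  moreover have "\<exists>D. (F2 has_field_derivative D) (at b)" for b
  proof -
    from lim(2) obtain D where
      "((\<lambda>H. (idem2 (F (idem_comb 0 b + H)) - idem2 (F (idem_comb 0 b))) / idem2 H) \<longlongrightarrow> D)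
         (at 0 within {H. H dvd 1})" by blast
    from filterlim_compose[OF this filterlim_diagonal]
    have "((\<lambda>h. (F2 (b + h) - F2 b) / h) \<longlongrightarrow> D) (at 0)"
      by (simp add: 2 flip: idem_comb_add)
    then show ?thesis unfolding DERIV_def by blast
  qed
  moreover have "F (idem_comb a b) = idem_comb (F1 a) (F2 b)" for a b
    by (intro idem_eqI) (auto simp: 1 2)
  ultimately show "\<exists>F1 F2. F1 holomorphic_on UNIV \<and> F2 holomorphic_on UNIV \<and>
        (\<forall>\<beta>1 \<beta>2. F (idem_comb \<beta>1 \<beta>2) = idem_comb (F1 \<beta>1) (F2 \<beta>2))"
    unfolding holomorphic_on_def field_differentiable_def by blast
next
  assume "\<exists>F1 F2. F1 holomorphic_on UNIV \<and> F2 holomorphic_on UNIV \<and>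
        (\<forall>\<beta>1 \<beta>2. F (idem_comb \<beta>1 \<beta>2) = idem_comb (F1 \<beta>1) (F2 \<beta>2))"
  then obtain F1 F2 where hol: "F1 holomorphic_on UNIV" "F2 holomorphic_on UNIV"
    and F: "\<And>\<beta>1 \<beta>2. F (idem_comb \<beta>1 \<beta>2) = idem_comb (F1 \<beta>1) (F2 \<beta>2)" by blast
  have F': "idem1 (F Z) = F1 (idem1 Z)" "idem2 (F Z) = F2 (idem2 Z)" for Z
    using F[of "idem1 Z" "idem2 Z"] by simp_all
  show "bc_entire F"
    unfolding bc_entire_def
  proof
    fix Z
    from hol obtain D1 D2 where
      "(F1 has_field_derivative D1) (at (idem1 Z))" "(F2 has_field_derivative D2) (at (idem2 Z))"
      unfolding holomorphic_on_def field_differentiable_def by blast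
    then have "((\<lambda>h. (F1 (idem1 Z + h) - F1 (idem1 Z)) / h) \<longlongrightarrow> D1) (at 0)"
      "((\<lambda>h. (F2 (idem2 Z + h) - F2 (idem2 Z)) / h) \<longlongrightarrow> D2) (at 0)"
      unfolding DERIV_def by blast+
    from filterlim_compose[OF this(1) filterlim_idem1] filterlim_compose[OF this(2) filterlim_idem2]
    have "bc_has_derivative F (idem_comb D1 D2) Z"
      unfolding bc_has_derivative_iff by (simp add: F')
    then show "\<exists>D. bc_has_derivative F D Z" ..
  qed
qed


section \<open>Hyperbolic numbers\<close>

text \<open>
  The hyperbolic numbers are a subset of the bicomplex numbers; \<open>k\<close> is \<open>bc_i * bc_j\<close>.
  The relation \<open>hyp_le\<close> is componentwise and implies that both sides are hyperbolic.
\<close>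

definition hyperbolic :: "bicomplex set" where
  "hyperbolic = {of_real a + bc_i * bc_j * of_real b | a b :: real. True}"

definition hyp_le :: "bicomplex \<Rightarrow> bicomplex \<Rightarrow> bool" where
  "hyp_le X Y \<longleftrightarrow> (\<exists>s1 s2 t1 t2 :: real.
     X = idem_comb (of_real s1) (of_real s2) \<and> Y = idem_comb (of_real t1) (of_real t2) \<and>
     s1 \<le> t1 \<and> s2 \<le> t2)"

definition hyp_norm :: "bicomplex \<Rightarrow> bicomplex" where
  "hyp_norm Z = idem_comb (of_real (cmod (idem1 Z))) (of_real (cmod (idem2 Z)))"

lemma hyperbolic_idem:
  "of_real a + bc_i * bc_j * of_real b = idem_comb (of_real (a + b)) (of_real (a - b))"
  by (intro idem_eqI) simp_all

lemma hyperbolic_iff: "X \<in> hyperbolic \<longleftrightarrow> (\<exists>s1 s2 :: real. X = idem_comb (of_real s1) (of_real s2))"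
proof
  assume "\<exists>s1 s2 :: real. X = idem_comb (of_real s1) (of_real s2)"
  then obtain s1 s2 :: real where "X = idem_comb (of_real s1) (of_real s2)" by blast
  then have "X = of_real ((s1 + s2) / 2) + bc_i * bc_j * of_real ((s1 - s2) / 2)"
    unfolding hyperbolic_idem by (simp add: field_simps)
  then show "X \<in> hyperbolic" unfolding hyperbolic_def by blast
next
  assume "X \<in> hyperbolic"
  then show "\<exists>s1 s2 :: real. X = idem_comb (of_real s1) (of_real s2)"
    unfolding hyperbolic_def hyperbolic_idem by blast
qed


section \<open>Hyperbolic intervals, integrals and square-integrable functions\<close>

definition hyp_interval :: "ereal \<Rightarrow> ereal \<Rightarrow> bicomplex set" where
  "hyp_interval a b =
     {idem_comb (of_real s1) (of_real s2) | s1 s2 :: real. s1 \<in> einterval a b \<and> s2 \<in> einterval a b}"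

definition product_type_on :: "ereal \<Rightarrow> ereal \<Rightarrow> (bicomplex \<Rightarrow> bicomplex) \<Rightarrow> bool" where
  "product_type_on a b G \<longleftrightarrow> (\<exists>G1 G2 :: real \<Rightarrow> complex.
     \<forall>s1\<in>einterval a b. \<forall>s2\<in>einterval a b.
       G (idem_comb (of_real s1) (of_real s2)) = idem_comb (G1 s1) (G2 s2))"

text \<open>
  The components \<open>G1\<close>, \<open>G2\<close> of a product-type function \<open>G\<close> are read off on the diagonal
  \<open>s1 = s2\<close>, which is contained in the hyperbolic interval.
\<close>

definition part1 :: "(bicomplex \<Rightarrow> bicomplex) \<Rightarrow> real \<Rightarrow> complex" where
  "part1 G s = idem1 (G (idem_comb (of_real s) (of_real s)))"

definition part2 :: "(bicomplex \<Rightarrow> bicomplex) \<Rightarrow> real \<Rightarrow> complex" where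
  "part2 G s = idem2 (G (idem_comb (of_real s) (of_real s)))"

lemma product_type_parts:
  assumes "\<forall>s1\<in>einterval a b. \<forall>s2\<in>einterval a b.
             G (idem_comb (of_real s1) (of_real s2)) = idem_comb (G1 s1) (G2 s2)"
    and "s \<in> einterval a b"
  shows "part1 G s = G1 s" "part2 G s = G2 s"
  using assms by (auto simp: part1_def part2_def)

text \<open>
  The library's integral is \<open>0\<close> for non-integrable functions.  For square-integrable components,
  bounded intervals and integrands as in \<open>hyp_integral_exp\<close> this does not occur, by
  \<open>square_integrable_exp_integrable\<close>.
\<close>

definition hyp_integral :: "ereal \<Rightarrow> ereal \<Rightarrow> (bicomplex \<Rightarrow> bicomplex) \<Rightarrow> bicomplex" where
  "hyp_integral a b G = idem_comb
     (integral\<^sup>L (lebesgue_on (einterval a b)) (part1 G))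
     (integral\<^sup>L (lebesgue_on (einterval a b)) (part2 G))"

text \<open>
  For an integrand with values in the nonnegative hyperbolic numbers the integral always exists
  as a pair of extended reals (its \<open>e\<close>- and \<open>e\<^sup>\<dagger>\<close>-component), and finiteness is componentwise.
\<close>

definition hyp_nn_integral ::
  "ereal \<Rightarrow> ereal \<Rightarrow> (bicomplex \<Rightarrow> bicomplex) \<Rightarrow> ennreal \<times> ennreal" where
  "hyp_nn_integral a b G =
     (\<integral>\<^sup>+s. ennreal (Re (part1 G s)) \<partial>lebesgue_on (einterval a b),
      \<integral>\<^sup>+s. ennreal (Re (part2 G s)) \<partial>lebesgue_on (einterval a b))"

definition hyp_finite :: "ennreal \<times> ennreal \<Rightarrow> bool" where
  "hyp_finite I \<longleftrightarrow> fst I < \<infinity> \<and> snd I < \<infinity>"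

definition square_integrable :: "ereal \<Rightarrow> ereal \<Rightarrow> (real \<Rightarrow> complex) \<Rightarrow> bool" where
  "square_integrable a b f \<longleftrightarrow>
     f \<in> borel_measurable (lebesgue_on (einterval a b)) \<and>
     integrable (lebesgue_on (einterval a b)) (\<lambda>s. (cmod (f s))\<^sup>2)"

text \<open>
  Elements of \<open>hyp_L2 a b\<close> are total functions; their values outside \<open>hyp_interval a b\<close> are
  irrelevant.
\<close>

definition hyp_L2 :: "ereal \<Rightarrow> ereal \<Rightarrow> (bicomplex \<Rightarrow> bicomplex) set" where
  "hyp_L2 a b = {G. product_type_on a b G \<and>
     square_integrable a b (part1 G) \<and> square_integrable a b (part2 G)}"

lemma square_integrable_exp_integrable:
  assumes "square_integrable (ereal a) (ereal b) f"
  shows "integrable (lebesgue_on (einterval (ereal a) (ereal b))) (\<lambda>t. f t * exp (\<i> * of_real t * w))"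
proof -
  let ?M = "lebesgue_on {a<..<b}"
  define K where "K = exp ((\<bar>a\<bar> + \<bar>b\<bar>) * cmod w)"
  have f: "f \<in> borel_measurable ?M" "integrable ?M (\<lambda>s. (cmod (f s))\<^sup>2)"
    using assms by (auto simp: square_integrable_def)
  have "continuous_on {a<..<b} (\<lambda>t. exp (\<i> * complex_of_real t * w))"
    by (intro continuous_intros)
  then have g: "(\<lambda>t. exp (\<i> * complex_of_real t * w)) \<in> borel_measurable ?M"
    by (rule continuous_imp_measurable_on_sets_lebesgue) auto
  have "integrable ?M (\<lambda>_. 1 :: real)"
    by (rule finite_measure.integrable_const, rule finite_measure_lebesgue_on) auto
  with f have dom: "integrable ?M (\<lambda>s. (1 + (cmod (f s))\<^sup>2) * K)"
    by (intro integrable_mult_left Bochner_Integration.integrable_add) auto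
  have "integrable ?M (\<lambda>t. f t * exp (\<i> * complex_of_real t * w))"
  proof (rule Bochner_Integration.integrable_bound[OF dom])
    show "AE t in ?M. norm (f t * exp (\<i> * of_real t * w)) \<le> norm ((1 + (cmod (f t))\<^sup>2) * K)"
    proof (rule AE_I2)
      fix t assume "t \<in> space ?M"
      then have t: "\<bar>t\<bar> \<le> \<bar>a\<bar> + \<bar>b\<bar>" by auto
      have "norm (exp (\<i> * of_real t * w)) \<le> exp (norm (\<i> * of_real t * w))"
        by (rule norm_exp)
      also have "\<dots> \<le> K"
        using t by (auto simp: K_def norm_mult intro: mult_right_mono)
      finally have 1: "norm (exp (\<i> * of_real t * w)) \<le> K" .
      have "0 \<le> (cmod (f t) - 1)\<^sup>2" by simp
      then have 2: "cmod (f t) \<le> 1 + (cmod (f t))\<^sup>2"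
        unfolding power2_diff using norm_ge_zero[of "f t"] by (simp del: norm_ge_zero)
      from 1 2 have "cmod (f t) * norm (exp (\<i> * of_real t * w)) \<le> (1 + (cmod (f t))\<^sup>2) * K"
        by (intro mult_mono) auto
      then show "norm (f t * exp (\<i> * of_real t * w)) \<le> norm ((1 + (cmod (f t))\<^sup>2) * K)"
        by (simp add: norm_mult K_def)
    qed
  qed (use f g in measurable)
  then show ?thesis by simp
qed

lemma hyp_nn_integral_norm_square:
  assumes "\<And>\<beta>1 \<beta>2. F (idem_comb \<beta>1 \<beta>2) = idem_comb (F1 \<beta>1) (F2 \<beta>2)"
  shows "hyp_nn_integral (-\<infinity>) \<infinity> (\<lambda>X. (hyp_norm (F X))\<^sup>2) =
    (\<integral>\<^sup>+s. ennreal ((cmod (F1 (of_real s)))\<^sup>2) \<partial>lebesgue,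
     \<integral>\<^sup>+s. ennreal ((cmod (F2 (of_real s)))\<^sup>2) \<partial>lebesgue)"
proof -
  have "Re ((complex_of_real x)\<^sup>2) = x\<^sup>2" for x by (simp flip: of_real_power)
  moreover have "einterval (-\<infinity>) \<infinity> = UNIV" by (auto simp: einterval_def)
  ultimately show ?thesis
    by (simp add: hyp_nn_integral_def part1_def part2_def hyp_norm_def assms lebesgue_on_UNIV_eq)
qed

lemma hyp_integral_exp:
  "hyp_integral a b (\<lambda>t. G t * bc_exp (bc_i * t * Z)) = idem_comb
     (integral\<^sup>L (lebesgue_on (einterval a b)) (\<lambda>t. part1 G t * exp (\<i> * of_real t * idem1 Z)))
     (integral\<^sup>L (lebesgue_on (einterval a b)) (\<lambda>t. part2 G t * exp (\<i> * of_real t * idem2 Z)))"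
  by (simp add: hyp_integral_def part1_def[abs_def] part2_def[abs_def] bc_exp_def)

end

theory Submission
  imports Defs "HOL-Real_Asymp.Real_Asymp" "HOL-Probability.Probability"
    "HOL-Complex_Analysis.Complex_Analysis"
begin

text \<open>
  Both idempotent components of \<open>F\<close> are entire functions \<open>f\<close> on the complex plane to which the
  classical Paley--Wiener theorem applies.  The Fourier transforms of \<open>f x * exp (- \<epsilon> * \<bar>x\<bar>)\<close> are
  Cauchy in \<open>L\<^sup>2\<close> as \<open>\<epsilon> \<rightarrow> 0\<close>, because the Fourier transform is bounded on \<open>L\<^sup>1 \<inter> L\<^sup>2\<close>.
  At a frequency \<open>\<tau>\<close> with \<open>\<bar>\<tau>\<bar> > A\<close> the two half-line integrals can be rotated to the same
  imaginary half-axis, where \<open>exp (- \<bar>\<tau>\<bar> * y)\<close> beats the growth of \<open>f\<close>, and there they cancel in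
  the limit; so the \<open>L\<^sup>2\<close> limit lives on \<open>(-A, A)\<close>.  Gaussian summation inverts the transform on the
  real line, and analytic continuation extends the formula to the plane.
\<close>

section \<open>The Fourier transform on integrable functions\<close>

text \<open>On the real line \<open>f\<close> is only known to be square integrable, so its Fourier
  integral need not converge absolutely. The damping exp (- \<epsilon> * \<bar>x\<bar>) restores
  this, and on each half-line it is the restriction of an entire exponential: each half becomes a
  Laplace integral of \<open>f\<close> at \<epsilon> + i \<tau> or \<epsilon> - i \<tau>, whose path
  can be turned. The obstacle there is that the type \<open>A\<close> is given by a bound in
  \<bar>z\<bar> and not in \<bar>Im z\<bar>: near the real axis the kernel decays only like exp (-
  \<epsilon> * \<bar>z\<bar>), too little against exp (A * \<bar>z\<bar>) for small \<epsilon>. The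
  L^2 limit says nothing about single frequencies, whereas vanishing beyond \<open>A\<close> is a
  pointwise statement; a subsequence converging almost everywhere links the two. Bounded support
  then makes the limit integrable, which gives the inverse integral a meaning at every complex
  argument. Gaussian weights serve twice, because their transforms are normal densities: they
  justify Fubini in the L^2 bound, and they provide the approximate identity in the inversion. The
  transform carries no normalizing factor, so \<open>2 * pi\<close> accompanies every formula until
  it is divided out of the final density.\<close>

definition fourier :: "(real \<Rightarrow> complex) \<Rightarrow> real \<Rightarrow> complex" where
  "fourier g t = (\<integral>x. g x * cis (- (t * x)) \<partial>lborel)"

lemma borel_measurable_cis [measurable]: "cis \<in> borel_measurable borel"
  by (intro borel_measurable_continuous_onI continuous_intros)

lemma borel_measurable_fourier [measurable]:
  assumes [measurable]: "g \<in> borel_measurable borel"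
  shows "fourier g \<in> borel_measurable borel"
  unfolding fourier_def[abs_def] by measurable

lemma integrable_times_cis:
  assumes "integrable lborel (g :: real \<Rightarrow> complex)"
  shows "integrable lborel (\<lambda>x. g x * cis (c * x))"
proof -
  have [measurable]: "g \<in> borel_measurable borel"
    using borel_measurable_integrable[OF assms] by simp
  show ?thesis
    by (rule Bochner_Integration.integrable_bound[OF assms]) (auto simp: norm_mult)
qed

section \<open>Gaussian weights and their transforms\<close>

lemma gauss_eq_normal_density:
  assumes "\<sigma> > 0"
  shows "exp (- (t\<^sup>2 / (2 * \<sigma>\<^sup>2))) = sqrt (2 * pi) * \<sigma> * normal_density 0 \<sigma> t"
  using assms by (simp add: normal_density_def real_sqrt_mult)

lemma integrable_gauss:
  assumes "\<sigma> > 0"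
  shows "integrable lborel (\<lambda>t::real. exp (- (t\<^sup>2 / (2 * \<sigma>\<^sup>2))))"
  unfolding gauss_eq_normal_density[OF assms] using assms by (intro integrable_mult_right integrable_normal_density) auto

text \<open>Rescaling by \<sigma> reduces the integral to the characteristic function of the
  standard normal law. The value is written as a normal density of width 1 / \<sigma> so that its
  total mass 1 is at hand in the later estimates.\<close>

lemma fourier_gauss:
  assumes "\<sigma> > 0"
  shows "(\<integral>t. cis (t * u) * of_real (exp (- (t\<^sup>2 / (2 * \<sigma>\<^sup>2)))) \<partial>lborel) =
    of_real (2 * pi * normal_density 0 (1 / \<sigma>) u)"
proof -
  define v where "v = \<sigma> * u"
  have "(\<integral>x. cis (v * x) \<partial>density lborel std_normal_density) = of_real (exp (- (v^2) / 2))"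
    using char_std_normal_distribution[THEN fun_cong, of v]
    by (simp add: char_def cis_conv_exp mult.commute)
  then have "(\<integral>x. std_normal_density x *\<^sub>R cis (v * x) \<partial>lborel) = of_real (exp (- (v^2) / 2))"
    by (subst (asm) integral_density) auto
  moreover have "(\<integral>t. cis (t * u) * of_real (exp (- (t\<^sup>2 / (2 * \<sigma>\<^sup>2)))) \<partial>lborel) =
      \<sigma> *\<^sub>R (\<integral>x. cis ((\<sigma> * x) * u) * of_real (exp (- ((\<sigma> * x)\<^sup>2 / (2 * \<sigma>\<^sup>2)))) \<partial>lborel)"
    using assms by (subst lborel_integral_real_affine[where c = \<sigma> and t = 0]) auto
  moreover have "cis ((\<sigma> * x) * u) * of_real (exp (- ((\<sigma> * x)\<^sup>2 / (2 * \<sigma>\<^sup>2)))) =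
      sqrt (2 * pi) *\<^sub>R (std_normal_density x *\<^sub>R cis (v * x))" for x
    using assms by (simp add: std_normal_density_def scaleR_conv_of_real power_mult_distrib v_def
        mult_ac real_sqrt_mult)
  ultimately have "(\<integral>t. cis (t * u) * of_real (exp (- (t\<^sup>2 / (2 * \<sigma>\<^sup>2)))) \<partial>lborel) =
      of_real (\<sigma> * sqrt (2 * pi) * exp (- (v^2) / 2))"
    by (simp add: scaleR_conv_of_real)
  also have "\<sigma> * sqrt (2 * pi) * exp (- (v^2) / 2) = 2 * pi * normal_density 0 (1 / \<sigma>) u"
  proof -
    have "2 * pi = sqrt (2 * pi) * sqrt (2 * pi)" by simp
    then show ?thesis
      using assms by (simp add: normal_density_def v_def real_sqrt_mult real_sqrt_divide power_mult_distrib
          field_simps)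
  qed
  finally show ?thesis .
qed

text \<open>The weight makes the double integral absolutely convergent, and after Fubini the
  integral over \<open>t\<close> is a normal density centred at \<open>y\<close>. The identity is
  the source of both the L^2 bound and the inversion formula.\<close>

lemma integral_fourier_gauss:
  assumes g: "integrable lborel g" and \<sigma>: "\<sigma> > 0"
  shows "(\<integral>t. fourier g t * (cis (t * y) * of_real (exp (- (t\<^sup>2 / (2 * \<sigma>\<^sup>2))))) \<partial>lborel) =
    of_real (2 * pi) * (\<integral>x. g x * of_real (normal_density 0 (1 / \<sigma>) (y - x)) \<partial>lborel)"
proof -
  let ?w = "\<lambda>t. exp (- (t\<^sup>2 / (2 * \<sigma>\<^sup>2)))"
  let ?h = "\<lambda>t x. g x * cis (- (t * x)) * (cis (t * y) * of_real (?w t))"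
  have [measurable]: "g \<in> borel_measurable borel"
    using borel_measurable_integrable[OF g] by simp
  have int: "integrable (lborel \<Otimes>\<^sub>M lborel) (\<lambda>(t, x). ?h t x)"
  proof (rule lborel_pair.Fubini_integrable)
    show "integrable lborel (\<lambda>t. \<integral>x. norm (case (t, x) of (t, x) \<Rightarrow> ?h t x) \<partial>lborel)"
      using integrable_gauss[OF \<sigma>] by (simp add: norm_mult)
    have "integrable lborel (?h t)" for t
      using integrable_times_cis[OF g, of "-t"] by (intro integrable_mult_left) simp
    then show "AE t in lborel. integrable lborel (\<lambda>x. case (t, x) of (t, x) \<Rightarrow> ?h t x)"
      by simp
  qed measurable
  have "(\<integral>t. fourier g t * (cis (t * y) * of_real (?w t)) \<partial>lborel) = (\<integral>t. \<integral>x. ?h t x \<partial>lborel \<partial>lborel)"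
    unfolding fourier_def by (intro Bochner_Integration.integral_cong refl) simp
  also have "\<dots> = (\<integral>x. \<integral>t. ?h t x \<partial>lborel \<partial>lborel)"
    using lborel_pair.Fubini_integral[OF int] by simp
  also have "\<dots> = (\<integral>x. of_real (2 * pi) * (g x * of_real (normal_density 0 (1 / \<sigma>) (y - x))) \<partial>lborel)"
  proof (intro Bochner_Integration.integral_cong refl)
    fix x
    have "cis (- (t * x)) * cis (t * y) = cis (t * (y - x))" for t
      by (simp add: cis_mult algebra_simps)
    then have eq: "?h t x = g x * (cis (t * (y - x)) * of_real (?w t))" for t
      by (metis mult.assoc)
    have "(\<integral>t. ?h t x \<partial>lborel) = g x * (\<integral>t. cis (t * (y - x)) * of_real (?w t) \<partial>lborel)"
      unfolding eq by simp
    also have "\<dots> = of_real (2 * pi) * (g x * of_real (normal_density 0 (1 / \<sigma>) (y - x)))"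
      by (subst fourier_gauss[OF \<sigma>]) simp
    finally show "(\<integral>t. ?h t x \<partial>lborel) = \<dots>" .
  qed
  finally show ?thesis by simp
qed

text \<open>If \<open>f\<close> is not integrable, the left side is 0 by the convention of the
  library. The bound therefore applies to iterated integrals without a proof that the inner ones
  exist.\<close>

lemma norm_integral_le_nn_integral:
  fixes f :: "'a \<Rightarrow> 'b::{banach, second_countable_topology}"
  shows "ennreal (norm (integral\<^sup>L M f)) \<le> (\<integral>\<^sup>+x. ennreal (norm (f x)) \<partial>M)"
  by (cases "integrable M f") (auto intro: integral_norm_bound_ennreal simp: not_integrable_integral_eq)

lemma norm_fourier_le:
  assumes "integrable lborel g"
  shows "norm (fourier g t) \<le> (\<integral>x. norm (g x) \<partial>lborel)"
  unfolding fourier_def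
  by (rule order_trans[OF integral_norm_bound]) (simp add: norm_mult)

section \<open>Boundedness of the transform on L^2\<close>

lemma nn_integral_normal_density_diff:
  assumes "s > 0"
  shows "(\<integral>\<^sup>+x. ennreal (normal_density 0 s (y - x)) \<partial>lborel) = 1"
    and "(\<integral>\<^sup>+y. ennreal (normal_density 0 s (y - x)) \<partial>lborel) = 1"
proof -
  have 1: "normal_density 0 s (y - x) = normal_density y s x" for x y
    by (simp add: normal_density_def power2_commute)
  have 2: "normal_density 0 s (y - x) = normal_density x s y" for x y
    by (simp add: normal_density_def)
  have 3: "(\<integral>\<^sup>+x. ennreal (normal_density z s x) \<partial>lborel) = 1" for z
    using assms by (subst nn_integral_eq_integral) auto
  show "(\<integral>\<^sup>+x. ennreal (normal_density 0 s (y - x)) \<partial>lborel) = 1"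
    unfolding 1 by (rule 3)
  show "(\<integral>\<^sup>+y. ennreal (normal_density 0 s (y - x)) \<partial>lborel) = 1"
    unfolding 2 by (rule 3)
qed

text \<open>This is the Schur test: a b \<le> (a^2 + b^2) / 2 separates the two factors, and the
  kernel has total mass 1 in either variable, so each term contributes half of the right side. The
  bound does not depend on the width \<open>s\<close>.\<close>

lemma nn_integral_convolution_le:
  fixes g :: "real \<Rightarrow> real"
  assumes [measurable]: "g \<in> borel_measurable borel" and s: "s > 0"
  shows "(\<integral>\<^sup>+y. \<integral>\<^sup>+x. ennreal (\<bar>g y\<bar> * (\<bar>g x\<bar> * normal_density 0 s (y - x))) \<partial>lborel \<partial>lborel)
    \<le> (\<integral>\<^sup>+x. ennreal ((g x)\<^sup>2) \<partial>lborel)"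
proof -
  let ?N = "\<lambda>x y. ennreal (normal_density 0 s (y - x))"
  have "(\<integral>\<^sup>+y. \<integral>\<^sup>+x. ennreal (\<bar>g y\<bar> * (\<bar>g x\<bar> * normal_density 0 s (y - x))) \<partial>lborel \<partial>lborel)
    \<le> (\<integral>\<^sup>+y. \<integral>\<^sup>+x. (ennreal ((g y)\<^sup>2 / 2) * ?N x y + ennreal ((g x)\<^sup>2 / 2) * ?N x y) \<partial>lborel \<partial>lborel)"
  proof (intro nn_integral_mono)
    fix x y
    have "0 \<le> (\<bar>g x\<bar> - \<bar>g y\<bar>)\<^sup>2" by simp
    then have "\<bar>g y\<bar> * \<bar>g x\<bar> \<le> (g y)\<^sup>2 / 2 + (g x)\<^sup>2 / 2"
      by (simp add: power2_diff algebra_simps)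
    then have "\<bar>g y\<bar> * \<bar>g x\<bar> * normal_density 0 s (y - x) \<le>
        ((g y)\<^sup>2 / 2 + (g x)\<^sup>2 / 2) * normal_density 0 s (y - x)"
      by (rule mult_right_mono) simp
    then show "ennreal (\<bar>g y\<bar> * (\<bar>g x\<bar> * normal_density 0 s (y - x))) \<le>
        ennreal ((g y)\<^sup>2 / 2) * ?N x y + ennreal ((g x)\<^sup>2 / 2) * ?N x y"
      by (simp add: distrib_right mult.assoc flip: ennreal_mult ennreal_plus)
  qed
  also have "\<dots> = (\<integral>\<^sup>+y. \<integral>\<^sup>+x. ennreal ((g y)\<^sup>2 / 2) * ?N x y \<partial>lborel \<partial>lborel) +
      (\<integral>\<^sup>+y. \<integral>\<^sup>+x. ennreal ((g x)\<^sup>2 / 2) * ?N x y \<partial>lborel \<partial>lborel)"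
    by (simp add: nn_integral_add)
  also have "(\<integral>\<^sup>+y. \<integral>\<^sup>+x. ennreal ((g x)\<^sup>2 / 2) * ?N x y \<partial>lborel \<partial>lborel) =
      (\<integral>\<^sup>+x. \<integral>\<^sup>+y. ennreal ((g x)\<^sup>2 / 2) * ?N x y \<partial>lborel \<partial>lborel)"
    by (rule lborel_pair.Fubini') simp
  also have "(\<integral>\<^sup>+x. \<integral>\<^sup>+y. ennreal ((g x)\<^sup>2 / 2) * ?N x y \<partial>lborel \<partial>lborel) =
      (\<integral>\<^sup>+x. ennreal ((g x)\<^sup>2 / 2) \<partial>lborel)"
    by (simp add: nn_integral_cmult nn_integral_normal_density_diff[OF s])
  also have "(\<integral>\<^sup>+y. \<integral>\<^sup>+x. ennreal ((g y)\<^sup>2 / 2) * ?N x y \<partial>lborel \<partial>lborel) =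
      (\<integral>\<^sup>+x. ennreal ((g x)\<^sup>2 / 2) \<partial>lborel)"
    by (simp add: nn_integral_cmult nn_integral_normal_density_diff[OF s])
  also have "(\<integral>\<^sup>+x. ennreal ((g x)\<^sup>2 / 2) \<partial>lborel) + (\<integral>\<^sup>+x. ennreal ((g x)\<^sup>2 / 2) \<partial>lborel) =
      (\<integral>\<^sup>+x. ennreal ((g x)\<^sup>2) \<partial>lborel)"
    by (simp flip: nn_integral_add ennreal_plus)
  finally show ?thesis .
qed

text \<open>A bounded transform becomes integrable under the weight, so Fubini turns the weighted
  square into a quadratic form in \<open>g\<close> whose kernel is a normal density. The resulting
  bound is free of \<sigma>.\<close>

lemma nn_integral_fourier_gauss_le:
  assumes g: "integrable lborel g" and \<sigma>: "\<sigma> > 0"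
  shows "(\<integral>\<^sup>+t. ennreal ((norm (fourier g t))\<^sup>2 * exp (- (t\<^sup>2 / (2 * \<sigma>\<^sup>2)))) \<partial>lborel) \<le>
    ennreal (2 * pi) * (\<integral>\<^sup>+x. ennreal ((norm (g x))\<^sup>2) \<partial>lborel)"
proof -
  let ?w = "\<lambda>t. exp (- (t\<^sup>2 / (2 * \<sigma>\<^sup>2)))"
  let ?N = "\<lambda>x y. normal_density 0 (1 / \<sigma>) (y - x)"
  let ?F = "fourier g"
  let ?h = "\<lambda>t y. cnj (g y) * (?F t * (cis (t * y) * of_real (?w t)))"
  have [measurable]: "g \<in> borel_measurable borel"
    using borel_measurable_integrable[OF g] by simp
  have [measurable]: "cnj \<in> borel_measurable borel"
    by (intro borel_measurable_continuous_onI continuous_intros)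
  define B where "B = (\<integral>x. norm (g x) \<partial>lborel)"
  have B: "norm (?F t) \<le> B" for t
    unfolding B_def by (rule norm_fourier_le[OF g])
  have Bnn: "B \<ge> 0"
    unfolding B_def by simp
  have Fw: "integrable lborel (\<lambda>t. norm (?F t) * ?w t)"
  proof (rule Bochner_Integration.integrable_bound)
    show "integrable lborel (\<lambda>t. B * ?w t)"
      using integrable_gauss[OF \<sigma>] by (intro integrable_mult_right) simp
    show "AE t in lborel. norm (norm (?F t) * ?w t) \<le> norm (B * ?w t)"
      using B Bnn by (auto simp: abs_mult intro!: mult_right_mono)
  qed measurable
  have FFw: "integrable lborel (\<lambda>t. (norm (?F t))\<^sup>2 * ?w t)"
  proof (rule Bochner_Integration.integrable_bound)
    show "integrable lborel (\<lambda>t. B * (norm (?F t) * ?w t))"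
      using Fw by (intro integrable_mult_right) simp
    show "AE t in lborel. norm ((norm (?F t))\<^sup>2 * ?w t) \<le> norm (B * (norm (?F t) * ?w t))"
      using B Bnn by (auto simp: abs_mult power2_eq_square mult.assoc intro!: mult_right_mono)
  qed measurable
  have int: "integrable (lborel \<Otimes>\<^sub>M lborel) (\<lambda>(t, y). ?h t y)"
  proof (rule lborel_pair.Fubini_integrable)
    have "(\<integral>y. norm (case (t, y) of (t, y) \<Rightarrow> ?h t y) \<partial>lborel) = B * (norm (?F t) * ?w t)" for t
      by (simp add: norm_mult B_def)
    then show "integrable lborel (\<lambda>t. \<integral>y. norm (case (t, y) of (t, y) \<Rightarrow> ?h t y) \<partial>lborel)"
      using Fw by simp
    have "integrable lborel (?h t)" for t
    proof (rule Bochner_Integration.integrable_bound)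
      show "integrable lborel (\<lambda>y. norm (g y) * (norm (?F t) * ?w t))"
        using g by (intro integrable_mult_left) simp
    qed (auto simp: norm_mult)
    then show "AE t in lborel. integrable lborel (\<lambda>y. case (t, y) of (t, y) \<Rightarrow> ?h t y)"
      by simp
  qed measurable
  have "of_real (\<integral>t. (norm (?F t))\<^sup>2 * ?w t \<partial>lborel) =
      (\<integral>t. complex_of_real ((norm (?F t))\<^sup>2 * ?w t) \<partial>lborel)"
    by (rule integral_complex_of_real[symmetric])
  \<comment> \<open>Only the conjugate factor is written out as an integral. The other one stays a
    transform, so that after the exchange the inner integral is exactly the one evaluated in
    \<open>integral_fourier_gauss\<close>.\<close>
  also have "\<dots> = (\<integral>t. \<integral>y. ?h t y \<partial>lborel \<partial>lborel)"
  proof (intro Bochner_Integration.integral_cong refl)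
    fix t
    have "cnj (?F t) = (\<integral>y. cnj (g y * cis (- (t * y))) \<partial>lborel)"
      unfolding fourier_def by (rule Bochner_Integration.integral_cnj[symmetric])
    also have "\<dots> = (\<integral>y. cnj (g y) * cis (t * y) \<partial>lborel)"
      by (simp add: cis_cnj)
    finally have "complex_of_real ((norm (?F t))\<^sup>2 * ?w t) =
        (\<integral>y. cnj (g y) * cis (t * y) \<partial>lborel) * (?F t * of_real (?w t))"
      by (simp add: complex_norm_square mult_ac del: of_real_power)
    also have "\<dots> = (\<integral>y. (cnj (g y) * cis (t * y)) * (?F t * of_real (?w t)) \<partial>lborel)"
      by simp
    also have "\<dots> = (\<integral>y. ?h t y \<partial>lborel)"
      by (intro Bochner_Integration.integral_cong refl) (simp add: mult_ac)
    finally show "complex_of_real ((norm (?F t))\<^sup>2 * ?w t) = (\<integral>y. ?h t y \<partial>lborel)" .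
  qed
  also have "\<dots> = (\<integral>y. \<integral>t. ?h t y \<partial>lborel \<partial>lborel)"
    using lborel_pair.Fubini_integral[OF int] by simp
  also have "\<dots> = (\<integral>y. cnj (g y) * (of_real (2 * pi) * (\<integral>x. g x * of_real (?N x y) \<partial>lborel)) \<partial>lborel)"
    using integral_fourier_gauss[OF g \<sigma>] by simp
  finally have eq: "complex_of_real (\<integral>t. (norm (?F t))\<^sup>2 * ?w t \<partial>lborel) = \<dots>" .
  have "(\<integral>\<^sup>+t. ennreal ((norm (?F t))\<^sup>2 * ?w t) \<partial>lborel) = ennreal (\<integral>t. (norm (?F t))\<^sup>2 * ?w t \<partial>lborel)"
    using FFw by (intro nn_integral_eq_integral) auto
  also have "\<dots> = ennreal (norm (complex_of_real (\<integral>t. (norm (?F t))\<^sup>2 * ?w t \<partial>lborel)))"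
    by (simp add: integral_nonneg_AE)
  also have "\<dots> \<le> (\<integral>\<^sup>+y. ennreal (norm (cnj (g y) * (of_real (2 * pi) * (\<integral>x. g x * of_real (?N x y) \<partial>lborel)))) \<partial>lborel)"
    unfolding eq by (rule norm_integral_le_nn_integral)
  also have "\<dots> \<le> (\<integral>\<^sup>+y. ennreal (2 * pi) * (\<integral>\<^sup>+x. ennreal (norm (g y) * (norm (g x) * ?N x y)) \<partial>lborel) \<partial>lborel)"
  proof (intro nn_integral_mono)
    fix y
    have "ennreal (norm (cnj (g y) * (of_real (2 * pi) * (\<integral>x. g x * of_real (?N x y) \<partial>lborel)))) =
        ennreal (2 * pi) * (ennreal (norm (g y)) * ennreal (norm (\<integral>x. g x * of_real (?N x y) \<partial>lborel)))"
      by (simp add: norm_mult mult_ac flip: ennreal_mult)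
    also have "\<dots> \<le> ennreal (2 * pi) * (ennreal (norm (g y)) * (\<integral>\<^sup>+x. ennreal (norm (g x * of_real (?N x y))) \<partial>lborel))"
      by (intro mult_left_mono norm_integral_le_nn_integral) auto
    also have "\<dots> = ennreal (2 * pi) * (\<integral>\<^sup>+x. ennreal (norm (g y) * (norm (g x) * ?N x y)) \<partial>lborel)"
      by (subst nn_integral_cmult[symmetric]) (auto simp: norm_mult ennreal_mult)
    finally show "ennreal (norm (cnj (g y) * (of_real (2 * pi) * (\<integral>x. g x * of_real (?N x y) \<partial>lborel)))) \<le> \<dots>" .
  qed
  also have "\<dots> = ennreal (2 * pi) * (\<integral>\<^sup>+y. \<integral>\<^sup>+x. ennreal (norm (g y) * (norm (g x) * ?N x y)) \<partial>lborel \<partial>lborel)"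
    by (rule nn_integral_cmult) measurable
  also have "\<dots> \<le> ennreal (2 * pi) * (\<integral>\<^sup>+x. ennreal ((norm (g x))\<^sup>2) \<partial>lborel)"
    using nn_integral_convolution_le[of "\<lambda>x. norm (g x)" "1 / \<sigma>"] \<sigma> by (intro mult_left_mono) auto
  finally show ?thesis .
qed

text \<open>The weights tend to 1 as \<sigma> grows, and Fatou's lemma carries the \<sigma>-free
  bound to the limit.\<close>

lemma nn_integral_fourier_le:
  assumes g: "integrable lborel g"
  shows "(\<integral>\<^sup>+t. ennreal ((norm (fourier g t))\<^sup>2) \<partial>lborel) \<le>
    ennreal (2 * pi) * (\<integral>\<^sup>+x. ennreal ((norm (g x))\<^sup>2) \<partial>lborel)"
proof -
  let ?w = "\<lambda>n t. exp (- (t\<^sup>2 / (2 * (real (Suc n))\<^sup>2)))"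
  let ?u = "\<lambda>n t. ennreal ((norm (fourier g t))\<^sup>2 * ?w n t)"
  have [measurable]: "g \<in> borel_measurable borel"
    using borel_measurable_integrable[OF g] by simp
  have "(\<lambda>n. ?w n t) \<longlonglongrightarrow> 1" for t :: real
    by real_asymp
  then have "(\<lambda>n. ?u n t) \<longlonglongrightarrow> ennreal ((norm (fourier g t))\<^sup>2 * 1)" for t
    by (intro tendsto_intros)
  then have "liminf (\<lambda>n. ?u n t) = ennreal ((norm (fourier g t))\<^sup>2)" for t
    using lim_imp_Liminf[of sequentially "\<lambda>n. ?u n t"] by simp
  then have "(\<integral>\<^sup>+t. ennreal ((norm (fourier g t))\<^sup>2) \<partial>lborel) = (\<integral>\<^sup>+t. liminf (\<lambda>n. ?u n t) \<partial>lborel)"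
    by simp
  also have "\<dots> \<le> liminf (\<lambda>n. \<integral>\<^sup>+t. ?u n t \<partial>lborel)"
    by (rule nn_integral_liminf) measurable
  also have "\<dots> \<le> ennreal (2 * pi) * (\<integral>\<^sup>+x. ennreal ((norm (g x))\<^sup>2) \<partial>lborel)"
    using nn_integral_fourier_gauss_le[OF g]
    by (intro Liminf_le always_eventually) auto
  finally show ?thesis .
qed

section \<open>Completeness of \<open>L\<^sup>2\<close>\<close>

text \<open>The squares are weighted by 2^k: since 2^k / 4^k is still summable, the weighted sum is
  finite almost everywhere, and d \<le> 2^(-k) + 2^k d^2 then makes the increments themselves
  summable. Working with squares keeps the argument valid on spaces of infinite measure such as the
  real line.\<close>

lemma fast_Cauchy_L2_converges_AE:
  fixes v :: "nat \<Rightarrow> 'a \<Rightarrow> complex"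
  assumes [measurable]: "\<And>n. v n \<in> borel_measurable M"
    and fast: "\<And>k. (\<integral>\<^sup>+x. ennreal ((norm (v (Suc k) x - v k x))\<^sup>2) \<partial>M) \<le> ennreal ((1 / 4) ^ k)"
  shows "AE x in M. convergent (\<lambda>k. v k x)"
proof -
  let ?d = "\<lambda>k x. norm (v (Suc k) x - v k x)"
  have "(\<integral>\<^sup>+x. (\<Sum>k. ennreal (2 ^ k * (?d k x)\<^sup>2)) \<partial>M) = (\<Sum>k. \<integral>\<^sup>+x. ennreal (2 ^ k * (?d k x)\<^sup>2) \<partial>M)"
    by (rule nn_integral_suminf) measurable
  also have "\<dots> \<le> (\<Sum>k. ennreal ((1 / 2) ^ k))"
  proof (rule suminf_le)
    fix k
    have "(\<integral>\<^sup>+x. ennreal (2 ^ k * (?d k x)\<^sup>2) \<partial>M) = ennreal (2 ^ k) * (\<integral>\<^sup>+x. ennreal ((?d k x)\<^sup>2) \<partial>M)"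
      by (subst nn_integral_cmult[symmetric]) (auto simp: ennreal_mult)
    also have "\<dots> \<le> ennreal (2 ^ k) * ennreal ((1 / 4) ^ k)"
      by (intro mult_left_mono fast) auto
    also have "\<dots> = ennreal ((1 / 2) ^ k)"
      by (simp flip: ennreal_mult power_mult_distrib)
    finally show "(\<integral>\<^sup>+x. ennreal (2 ^ k * (?d k x)\<^sup>2) \<partial>M) \<le> ennreal ((1 / 2) ^ k)" .
  qed auto
  also have "\<dots> = ennreal (\<Sum>k. (1 / 2) ^ k)"
    by (rule suminf_ennreal2) (auto intro: summable_geometric)
  also have "\<dots> < \<infinity>" by simp
  finally have "AE x in M. (\<Sum>k. ennreal (2 ^ k * (?d k x)\<^sup>2)) \<noteq> \<infinity>"
    by (intro nn_integral_noteq_infinite) auto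
  then show ?thesis
  proof eventually_elim
    fix x assume "(\<Sum>k. ennreal (2 ^ k * (?d k x)\<^sup>2)) \<noteq> \<infinity>"
    then have sum: "summable (\<lambda>k. 2 ^ k * (?d k x)\<^sup>2)"
      by (intro summable_suminf_not_top) auto
    have "summable (\<lambda>k. v (Suc k) x - v k x)"
    proof (rule summable_comparison_test')
      show "summable (\<lambda>k. (1 / 2) ^ k + 2 ^ k * (?d k x)\<^sup>2)"
        by (intro summable_add sum summable_geometric) auto
      fix k :: nat assume "0 \<le> k"
      \<comment> \<open>AM-GM\<close>
      have "(1 / 2) ^ k + 2 ^ k * d\<^sup>2 \<ge> d" if "d \<ge> 0" for d :: real
      proof -
        have "0 \<le> (1 / 2) ^ k * (1 - 2 ^ k * d)\<^sup>2" by simp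
        also have "\<dots> = (1 / 2) ^ k + 2 ^ k * d\<^sup>2 - 2 * d"
          by (simp add: power2_eq_square field_simps)
        finally show ?thesis using that by simp
      qed
      then show "?d k x \<le> (1 / 2) ^ k + 2 ^ k * (?d k x)\<^sup>2" by simp
    qed
    moreover have "(\<Sum>k<n. v (Suc k) x - v k x) = v n x - v 0 x" for n
      by (rule sum_lessThan_telescope)
    ultimately have "convergent (\<lambda>n. (v n x - v 0 x) + v 0 x)"
      by (intro convergent_add convergent_const) (simp add: summable_iff_convergent)
    then show "convergent (\<lambda>k. v k x)" by simp
  qed
qed

text \<open>Fatou's lemma along an almost everywhere convergent subsequence gives convergence of the
  whole sequence in L^2. The subsequence is part of the conclusion because the support of the limit
  is later read off pointwise.\<close>

lemma L2_complete:
  fixes u :: "nat \<Rightarrow> 'a \<Rightarrow> complex"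
  assumes [measurable]: "\<And>n. u n \<in> borel_measurable M"
    and Cauchy: "\<And>e. e > 0 \<Longrightarrow> \<exists>N. \<forall>m\<ge>N. \<forall>n\<ge>N. (\<integral>\<^sup>+x. ennreal ((norm (u m x - u n x))\<^sup>2) \<partial>M) \<le> ennreal e"
  obtains \<phi> r where "\<phi> \<in> borel_measurable M" "strict_mono r"
    "AE x in M. (\<lambda>k. u (r k) x) \<longlonglongrightarrow> \<phi> x"
    "(\<lambda>n. \<integral>\<^sup>+x. ennreal ((norm (u n x - \<phi> x))\<^sup>2) \<partial>M) \<longlonglongrightarrow> 0"
proof -
  let ?D = "\<lambda>m n. \<integral>\<^sup>+x. ennreal ((norm (u m x - u n x))\<^sup>2) \<partial>M"
  have "\<exists>N. \<forall>k. \<forall>m\<ge>N k. \<forall>n\<ge>N k. ?D m n \<le> ennreal ((1 / 4) ^ k)"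
    by (intro choice allI Cauchy) simp
  then obtain N where N: "\<And>k m n. m \<ge> N k \<Longrightarrow> n \<ge> N k \<Longrightarrow> ?D m n \<le> ennreal ((1 / 4) ^ k)"
    by blast
  \<comment> \<open>The summand \<open>k\<close> makes \<open>r\<close> strictly increasing, and the
    cumulative sum dominates \<open>N k\<close> although \<open>N\<close> need not be
    monotone.\<close>
  define r where "r = (\<lambda>k. k + (\<Sum>i\<le>k. N i))"
  have r: "strict_mono r"
    by (rule strict_monoI_Suc) (simp add: r_def)
  have rN: "N k \<le> r k" for k
    by (simp add: r_def trans_le_add2 member_le_sum)
  define \<phi> where "\<phi> = (\<lambda>x. lim (\<lambda>k. u (r k) x))"
  have [measurable]: "\<phi> \<in> borel_measurable M"
    unfolding \<phi>_def by measurable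
  have "AE x in M. convergent (\<lambda>k. u (r k) x)"
  proof (rule fast_Cauchy_L2_converges_AE)
    fix k
    have "r k \<le> r (Suc k)" using r by (simp add: strict_mono_leD)
    then show "?D (r (Suc k)) (r k) \<le> ennreal ((1 / 4) ^ k)"
      using rN[of k] by (intro N) auto
  qed measurable
  then have AE: "AE x in M. (\<lambda>k. u (r k) x) \<longlonglongrightarrow> \<phi> x"
    by eventually_elim (simp add: \<phi>_def convergent_LIMSEQ_iff)
  have "(\<lambda>n. \<integral>\<^sup>+x. ennreal ((norm (u n x - \<phi> x))\<^sup>2) \<partial>M) \<longlonglongrightarrow> 0"
  proof (rule tendsto_zero_ennreal)
    fix e :: real assume e: "0 < e"
    then obtain N where N: "\<And>m n. m \<ge> N \<Longrightarrow> n \<ge> N \<Longrightarrow> ?D m n \<le> ennreal (e / 2)"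
      using Cauchy[of "e / 2"] by auto
    show "\<forall>\<^sub>F n in sequentially. (\<integral>\<^sup>+x. ennreal ((norm (u n x - \<phi> x))\<^sup>2) \<partial>M) < ennreal e"
      using eventually_ge_at_top[of N]
    proof eventually_elim
      fix n assume n: "n \<ge> N"
      have "(\<integral>\<^sup>+x. ennreal ((norm (u n x - \<phi> x))\<^sup>2) \<partial>M) =
          (\<integral>\<^sup>+x. liminf (\<lambda>k. ennreal ((norm (u n x - u (r k) x))\<^sup>2)) \<partial>M)"
      proof (rule nn_integral_cong_AE, use AE in eventually_elim)
        fix x assume "(\<lambda>k. u (r k) x) \<longlonglongrightarrow> \<phi> x"
        then have "(\<lambda>k. ennreal ((norm (u n x - u (r k) x))\<^sup>2)) \<longlonglongrightarrow> ennreal ((norm (u n x - \<phi> x))\<^sup>2)"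
          by (intro tendsto_intros)
        then show "ennreal ((norm (u n x - \<phi> x))\<^sup>2) = liminf (\<lambda>k. ennreal ((norm (u n x - u (r k) x))\<^sup>2))"
          by (intro lim_imp_Liminf[symmetric]) auto
      qed
      also have "\<dots> \<le> liminf (\<lambda>k. ?D n (r k))"
        by (rule nn_integral_liminf) measurable
      also have "\<dots> \<le> ennreal (e / 2)"
      proof (rule Liminf_le)
        show "\<forall>\<^sub>F k in sequentially. ?D n (r k) \<le> ennreal (e / 2)"
          using eventually_ge_at_top[of N]
        proof eventually_elim
          fix k assume "k \<ge> N"
          then have "r k \<ge> N" using seq_suble[OF r, of k] by simp
          then show "?D n (r k) \<le> ennreal (e / 2)" by (intro N n)
        qed
      qed simp
      also have "\<dots> < ennreal e" using e by (simp add: ennreal_lessI)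
      finally show "(\<integral>\<^sup>+x. ennreal ((norm (u n x - \<phi> x))\<^sup>2) \<partial>M) < ennreal e" .
    qed
  qed
  with r AE show ?thesis by (intro that[of \<phi> r]) auto
qed

section \<open>Rotating the line of integration\<close>

text \<open>The argument of \<zeta> is within \<pi> / 4, so that of its power 3/2 is within 3 \<pi>
  / 8, where the cosine is positive. In coordinates, with csqrt \<zeta> = p + i q and a = Re
  \<zeta>, the real part is p^3 - 3 p q^2 = p (a - 2 q^2); the sector forces 4 q^2 \<le> a, and p
  \<ge> sqrt a. The constant 1/4 is not sharp.\<close>

lemma Re_times_csqrt_ge:
  assumes "\<bar>Im \<zeta>\<bar> \<le> Re \<zeta>"
  shows "Re (\<zeta> * csqrt \<zeta>) \<ge> Re \<zeta> * sqrt (Re \<zeta>) / 4"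
proof -
  define a where "a = Re \<zeta>"
  define p where "p = Re (csqrt \<zeta>)"
  define q where "q = Im (csqrt \<zeta>)"
  have a: "a \<ge> 0" using assms by (simp add: a_def)
  have p: "p \<ge> 0" unfolding p_def by (rule Re_csqrt)
  have sq: "csqrt \<zeta> = Complex p q" by (simp add: p_def q_def complex_eq_iff del: csqrt.sel)
  have \<zeta>: "\<zeta> = Complex p q * Complex p q"
    using power2_csqrt[of \<zeta>] unfolding sq power2_eq_square by simp
  have a_eq: "a = p\<^sup>2 - q\<^sup>2"
    using \<zeta> by (simp add: a_def power2_eq_square)
  have "norm \<zeta> = p\<^sup>2 + q\<^sup>2"
    unfolding \<zeta> norm_mult by (simp add: cmod_def)
  \<comment> \<open>3/2 is a rational substitute for the sharp constant sqrt 2; the slack still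
    yields 4 q^2 \<le> a.\<close>
  moreover have "norm \<zeta> \<le> 3 / 2 * a"
  proof (rule power2_le_imp_le)
    have "(Im \<zeta>)\<^sup>2 \<le> a\<^sup>2"
      using assms unfolding a_def abs_le_square_iff[symmetric] by simp
    moreover have "(norm \<zeta>)\<^sup>2 = a\<^sup>2 + (Im \<zeta>)\<^sup>2"
      by (simp add: cmod_power2 a_def)
    moreover have "(3 / 2 * a)\<^sup>2 = 9 / 4 * a\<^sup>2"
      by (simp add: power_mult_distrib power_divide)
    ultimately show "(norm \<zeta>)\<^sup>2 \<le> (3 / 2 * a)\<^sup>2"
      using zero_le_power2[of a] by linarith
  qed (use a in simp)
  ultimately have *: "4 * q\<^sup>2 \<le> a" "a \<le> p\<^sup>2"
    unfolding a_eq by auto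
  have "sqrt a \<le> p"
    using * p by (simp add: real_le_lsqrt)
  then have "a * sqrt a / 4 \<le> p * (a / 4)"
    using mult_right_mono[of "sqrt a" p a] a by (simp add: mult.commute)
  also have "\<dots> \<le> p * (a - 2 * q\<^sup>2)"
    using * p a by (intro mult_left_mono) auto
  also have "\<dots> = Re (Complex p q * Complex p q * Complex p q)"
    by (simp add: a_eq power2_eq_square algebra_simps)
  also have "\<dots> = Re (\<zeta> * csqrt \<zeta>)"
    unfolding sq \<zeta>[symmetric] ..
  finally show ?thesis by (simp add: a_def)
qed

text \<open>Cauchy's theorem in terms of a primitive \<open>H\<close> on a convex set: each ray
  integral is a difference of values of \<open>H\<close> starting from \<open>H 0\<close>, so they
  differ by \<open>H R - H (u * R)\<close>. This is estimated along the chord and not along an arc;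
  the chord stays in \<open>S\<close> by convexity.\<close>

lemma norm_diff_ray_integrals_le:
  fixes u :: complex
  assumes h: "h holomorphic_on S" and S: "open S" "convex S" and R: "R \<ge> 0"
    and rays: "\<And>x. x \<in> {0..R} \<Longrightarrow> of_real x \<in> S" "\<And>x. x \<in> {0..R} \<Longrightarrow> u * of_real x \<in> S"
    and B: "\<And>z. z \<in> closed_segment (of_real R) (u * of_real R) \<Longrightarrow> norm (h z) \<le> B"
  shows "norm ((LBINT x:{0..R}. h (of_real x)) - u * (LBINT x:{0..R}. h (u * of_real x)))
    \<le> B * norm (of_real R - u * of_real R)"
proof -
  obtain H where H: "\<And>z. z \<in> S \<Longrightarrow> (H has_field_derivative h z) (at z)"
    using holomorphic_convex_primitive'[OF S(2,1) h] S(1) by (metis at_within_open)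
  have FTC: "v * (LBINT x:{0..R}. h (v * of_real x)) = H (v * of_real R) - H 0"
    if v: "\<And>x. x \<in> {0..R} \<Longrightarrow> v * of_real x \<in> S" for v
  proof -
    have "(LBINT x. indicator {0..R} x *\<^sub>R (v * h (v * of_real x))) = H (v * of_real R) - H (v * of_real 0)"
    proof (rule integral_FTC_Icc[OF R])
      fix x assume "0 \<le> x" "x \<le> R"
      then have "(H has_field_derivative h (v * of_real x)) (at (v * of_real x))"
        using v by (intro H) auto
      moreover have "((\<lambda>x. v * complex_of_real x) has_vector_derivative v) (at x)"
        by (auto intro!: derivative_eq_intros)
      ultimately have "((H \<circ> (\<lambda>x. v * complex_of_real x)) has_vector_derivative v * h (v * of_real x)) (at x)"
        by (intro field_vector_diff_chain_at)
      then show "((\<lambda>x. H (v * of_real x)) has_vector_derivative v * h (v * of_real x)) (at x within {0..R})"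
        by (auto intro!: has_vector_derivative_at_within simp: o_def)
    next
      show "continuous_on {0..R} (\<lambda>x. v * h (v * of_real x))"
        using v by (intro continuous_intros continuous_on_compose2[OF holomorphic_on_imp_continuous_on[OF h]]) auto
    qed
    then show ?thesis
      unfolding set_lebesgue_integral_def[symmetric] set_integral_mult_right by simp
  qed
  have "norm (H (of_real R) - H (u * of_real R)) \<le> B * norm (of_real R - u * of_real R)"
  proof (rule field_differentiable_bound[where S = "closed_segment (of_real R) (u * of_real R)"])
    have "closed_segment (of_real R) (u * of_real R) \<subseteq> S"
      using S R rays by (intro closed_segment_subset) auto
    then show "(H has_field_derivative h z) (at z within closed_segment (of_real R) (u * of_real R))"
      if "z \<in> closed_segment (of_real R) (u * of_real R)" for z
      using that by (intro has_field_derivative_at_within[OF H]) auto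
  qed (use B in auto)
  then show ?thesis
    using FTC[of 1] FTC[of u] rays by simp
qed

lemma integrable_exp_decay:
  assumes "u > (0::real)"
  shows "set_integrable lborel {0..} (\<lambda>x::real. exp (- (u * x)))"
proof -
  have "integrable lborel (\<lambda>x. indicator {0<..} x *\<^sub>R exp (- (x * u)))"
    using integrable_I0i_exp_mscale[OF assms] by (simp add: set_integrable_def)
  moreover have "AE x in lborel. indicator {0<..} x *\<^sub>R exp (- (x * u)) = indicator {0..} x *\<^sub>R exp (- (u * x))"
    using AE_lborel_singleton[of "0::real"] by eventually_elim (auto simp: indicator_def mult.commute)
  ultimately show ?thesis
    unfolding set_integrable_def by (subst (asm) integrable_cong_AE) auto
qed

text \<open>\<open>csqrt\<close> jumps across the negative real axis, so measurability comes from
  the explicit real and imaginary parts and not from continuity.\<close>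

lemma borel_measurable_csqrt [measurable]: "csqrt \<in> borel_measurable borel"
proof -
  have eq: "csqrt = (\<lambda>z. of_real (sqrt ((cmod z + Re z) / 2)) +
      \<i> * of_real ((if Im z = 0 then 1 else sgn (Im z)) * sqrt ((cmod z - Re z) / 2)))"
    by (auto simp: fun_eq_iff complex_eq_iff)
  show ?thesis by (subst eq) measurable
qed

text \<open>
  A bound of order \<open>exp (A * \<bar>z\<bar>)\<close> gives no decay inside the quadrant, so the integrand is damped by
  \<open>exp (- \<zeta> powr (3/2) / n)\<close>, where \<open>\<zeta>\<close> maps the quadrant into the sector \<open>\<bar>arg \<zeta>\<bar> \<le> \<pi> / 4\<close>:
  the order \<open>3/2\<close> exceeds \<open>1\<close>, and it is below \<open>2\<close>, so that the real part of \<open>\<zeta> powr (3/2)\<close> stays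
  comparable to its modulus.  The radius \<open>n ^ 4\<close> grows fast enough for the damping to win at scale
  \<open>1 / n\<close>.
\<close>

lemma rotate_laplace_ray:
  fixes f :: "complex \<Rightarrow> complex" and s A C \<epsilon> t :: real
  assumes hol: "f holomorphic_on UNIV"
    and growth: "\<And>z. norm (f z) \<le> C * exp (A * norm z)"
    and "A > 0" and s: "s = 1 \<or> s = -1" and t: "t > A" and \<epsilon>: "\<epsilon> > 0"
    and int: "set_integrable lborel {0..} (\<lambda>x. f (of_real x) * of_real (exp (- (\<epsilon> * x))))"
  shows "(LBINT x:{0..}. f (of_real x) * exp (- Complex \<epsilon> (s * t) * of_real x)) =
    - \<i> * of_real s * (LBINT y:{0..}. f (- \<i> * of_real s * of_real y) * exp (Complex (- t) (s * \<epsilon>) * of_real y))"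
proof -
  define w where "w = Complex \<epsilon> (s * t)"
  \<comment> \<open>The direction in which the kernel decays best against \<open>f\<close>:
    \<open>w * u\<close> has real part \<open>t\<close>, which exceeds \<open>A\<close>. The sign
    \<open>s\<close> selects the lower or the upper half-axis.\<close>
  define u where "u = - \<i> * complex_of_real s"
  \<comment> \<open>The factor 1 + i s turns the quadrant between the positive real axis and the ray
    of \<open>u\<close> into the sector around the positive axis. The summand 1 moves the image,
    corner included, into an open half-plane that avoids the branch cut of
    \<open>csqrt\<close>.\<close>
  define \<zeta> where "\<zeta> = (\<lambda>z. 1 + Complex 1 s * z)"
  define P where "P = (\<lambda>z. \<zeta> z * csqrt (\<zeta> z))"
  define S where "S = {z. Re (\<zeta> z) > 0}"
  define R where "R = (\<lambda>n. real (Suc n) ^ 4)"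
  define reg where "reg = (\<lambda>n z. exp (- P z / of_nat (Suc n)))"
  define h where "h = (\<lambda>n z. f z * exp (- w * z) * reg n z)"
  have ss: "s * s = 1" using s by auto
  have [measurable]: "f \<in> borel_measurable borel"
    by (intro borel_measurable_continuous_onI holomorphic_on_imp_continuous_on hol)
  have [measurable]: "\<zeta> \<in> borel_measurable borel"
    unfolding \<zeta>_def by measurable
  have [measurable]: "reg n \<in> borel_measurable borel" for n
    unfolding reg_def P_def by measurable
  have C: "C \<ge> 0"
    using growth[of 0] norm_ge_zero[of "f 0"] by (simp del: norm_ge_zero)
  have Re_\<zeta>: "Re (\<zeta> z) = 1 + Re z - s * Im z" and Im_\<zeta>: "Im (\<zeta> z) = Im z + s * Re z" for z
    by (simp_all add: \<zeta>_def)
  have S_eq: "S = {z. Re z - s * Im z > -1}"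
    by (auto simp: S_def Re_\<zeta>)
  have "open S" unfolding S_def \<zeta>_def
    by (intro open_Collect_less continuous_intros)
  have "convex S"
    using convex_halfspace_gt[of "-1" "Complex 1 (- s)"] by (simp add: S_eq inner_complex_def)
  have hol_h: "h n holomorphic_on S" for n
  proof -
    have "\<zeta> z \<notin> \<real>\<^sub>\<le>\<^sub>0" if "z \<in> S" for z
      using that by (auto simp: S_def complex_nonpos_Reals_iff)
    then show ?thesis
      unfolding h_def reg_def P_def
      by (intro holomorphic_intros holomorphic_on_subset[OF hol]) (auto simp: \<zeta>_def intro!: holomorphic_intros)
  qed
  have sector: "Re (P z) \<ge> (Re z - s * Im z) * sqrt (Re z - s * Im z) / 4"
    if "Re z \<ge> 0" "s * Im z \<le> 0" for z
  proof -
    have "\<bar>Im (\<zeta> z)\<bar> \<le> Re (\<zeta> z)"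
      using that s unfolding Re_\<zeta> Im_\<zeta> by auto
    from Re_times_csqrt_ge[OF this] have "Re (\<zeta> z) * sqrt (Re (\<zeta> z)) / 4 \<le> Re (P z)"
      by (simp add: P_def)
    moreover have "(Re z - s * Im z) * sqrt (Re z - s * Im z) \<le> Re (\<zeta> z) * sqrt (Re (\<zeta> z))"
      using that unfolding Re_\<zeta> by (intro mult_mono real_sqrt_le_mono) auto
    ultimately show ?thesis by simp
  qed
  have norm_reg: "norm (reg n z) \<le> 1" if "Re z \<ge> 0" "s * Im z \<le> 0" for n z
  proof -
    have "0 \<le> Re (P z)"
      using that by (intro order_trans[OF _ sector[OF that]]) auto
    then show ?thesis by (simp add: reg_def del: of_nat_Suc)
  qed
  have reg_lim: "(\<lambda>n. reg n z) \<longlonglongrightarrow> 1" for z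
  proof -
    have "(\<lambda>n. - P z / of_nat n) \<longlonglongrightarrow> 0"
      by (rule tendsto_divide_0[OF tendsto_const tendsto_of_nat])
    from tendsto_exp[OF LIMSEQ_Suc[OF this]] show ?thesis
      unfolding reg_def by simp
  qed
  have R: "eventually (\<lambda>n. x \<le> R n) sequentially" for x
    unfolding R_def by real_asymp
  \<comment> \<open>On the quadrant \<open>reg\<close> has norm at most 1, and \<open>R n\<close>
    eventually passes every \<open>x\<close>. One dominated convergence serves both rays, with
    \<open>v = 1\<close> and \<open>v = u\<close>.\<close>
  have DCT: "(\<lambda>n. LBINT x:{0..R n}. g x * reg n (v * of_real x)) \<longlonglongrightarrow> (LBINT x:{0..}. g x)"
    if g: "set_integrable lborel {0..} g" and [measurable]: "g \<in> borel_measurable borel"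
      and v: "Re v \<ge> 0" "s * Im v \<le> 0" for g :: "real \<Rightarrow> complex" and v
    unfolding set_lebesgue_integral_def
  proof (rule integral_dominated_convergence)
    show "integrable lborel (\<lambda>x. norm (indicator {0..} x *\<^sub>R g x))"
      using g unfolding set_integrable_def by (rule integrable_norm)
    show "AE x in lborel. (\<lambda>n. indicator {0..R n} x *\<^sub>R (g x * reg n (v * of_real x))) \<longlonglongrightarrow> indicator {0..} x *\<^sub>R g x"
    proof (intro AE_I2)
      fix x :: real
      have "(\<lambda>n. indicator {0..} x *\<^sub>R (g x * reg n (v * of_real x))) \<longlonglongrightarrow> indicator {0..} x *\<^sub>R (g x * 1)"
        by (intro tendsto_intros reg_lim)
      moreover have "eventually (\<lambda>n. indicator {0..} x *\<^sub>R (g x * reg n (v * of_real x)) =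
          indicator {0..R n} x *\<^sub>R (g x * reg n (v * of_real x))) sequentially"
        using R[of x] by eventually_elim (auto simp: indicator_def)
      ultimately show "(\<lambda>n. indicator {0..R n} x *\<^sub>R (g x * reg n (v * of_real x))) \<longlonglongrightarrow> indicator {0..} x *\<^sub>R g x"
        by (simp add: tendsto_cong)
    qed
    show "AE x in lborel. norm (indicator {0..R n} x *\<^sub>R (g x * reg n (v * of_real x))) \<le> norm (indicator {0..} x *\<^sub>R g x)" for n
    proof (intro AE_I2)
      fix x :: real
      show "norm (indicator {0..R n} x *\<^sub>R (g x * reg n (v * of_real x))) \<le> norm (indicator {0..} x *\<^sub>R g x)"
      proof (cases "x \<ge> 0")
        case True
        have "norm (reg n (v * of_real x)) \<le> 1"
          using v True by (intro norm_reg) (auto simp: mult_nonpos_nonneg simp flip: mult.assoc)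
        then have "norm (g x * reg n (v * of_real x)) \<le> norm (g x) * 1"
          unfolding norm_mult by (intro mult_left_mono) auto
        then show ?thesis by (auto simp: indicator_def)
      qed auto
    qed
  qed measurable
  have uw: "w * u = - Complex (- t) (s * \<epsilon>)"
    using ss by (simp add: w_def u_def complex_eq_iff algebra_simps)
  have lim1: "(\<lambda>n. LBINT x:{0..R n}. h n (of_real x)) \<longlonglongrightarrow> (LBINT x:{0..}. f (of_real x) * exp (- w * of_real x))"
  proof -
    have "set_integrable lborel {0..} (\<lambda>x. f (of_real x) * exp (- w * of_real x))"
      by (rule set_integrable_bound[OF int]) (auto simp: set_borel_measurable_def norm_mult w_def)
    from DCT[OF this, of 1] show ?thesis by (simp add: h_def)
  qed
  have lim2: "(\<lambda>n. LBINT x:{0..R n}. h n (u * of_real x)) \<longlonglongrightarrow>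
      (LBINT y:{0..}. f (u * of_real y) * exp (- w * (u * of_real y)))"
  proof -
    have ex: "set_integrable lborel {0..} (\<lambda>x. C * exp (- ((t - A) * x)))"
      using integrable_exp_decay[of "t - A"] t by (intro set_integrable_mult_right) simp
    have "set_integrable lborel {0..} (\<lambda>x. f (u * of_real x) * exp (- w * (u * of_real x)))"
    proof (rule set_integrable_bound[OF ex])
      show "AE x in lborel. x \<in> {0..} \<longrightarrow> norm (f (u * of_real x) * exp (- w * (u * of_real x))) \<le> norm (C * exp (- ((t - A) * x)))"
      proof (intro AE_I2 impI)
        fix x :: real assume "x \<in> {0..}"
        have "norm u = 1" using s by (auto simp: u_def norm_mult)
        then have "norm (f (u * of_real x)) \<le> C * exp (A * x)"
          using growth[of "u * of_real x"] \<open>x \<in> {0..}\<close> by (simp add: norm_mult)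
        moreover have "norm (exp (- w * (u * of_real x))) = exp (- (t * x))"
          using uw by (simp flip: mult.assoc)
        ultimately have "norm (f (u * of_real x) * exp (- w * (u * of_real x))) \<le> C * exp (A * x) * exp (- (t * x))"
          unfolding norm_mult by (simp add: mult_right_mono)
        also have "\<dots> = C * exp (- ((t - A) * x))"
          by (simp add: algebra_simps flip: exp_add)
        finally show "norm (f (u * of_real x) * exp (- w * (u * of_real x))) \<le> norm (C * exp (- ((t - A) * x)))"
          using C by simp
      qed
    qed (auto simp: set_borel_measurable_def)
    from DCT[OF this, of u] show ?thesis
      using ss by (simp add: h_def u_def)
  qed
  have "(\<lambda>n. (LBINT x:{0..R n}. h n (of_real x)) - u * (LBINT x:{0..R n}. h n (u * of_real x))) \<longlonglongrightarrow> 0"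
  proof (rule Lim_null_comparison)
    define K where "K = A + norm w"
    let ?B = "\<lambda>n. C * exp (K * real (Suc n) ^ 4) * exp (- (real (Suc n) ^ 5 / 4))"
    show "\<forall>\<^sub>F n in sequentially. norm ((LBINT x:{0..R n}. h n (of_real x)) - u * (LBINT x:{0..R n}. h n (u * of_real x)))
        \<le> ?B n * (2 * real (Suc n) ^ 4)"
    proof (intro always_eventually allI)
      fix n
      have R0: "R n \<ge> 0" by (simp add: R_def)
      have "norm ((LBINT x:{0..R n}. h n (of_real x)) - u * (LBINT x:{0..R n}. h n (u * of_real x)))
          \<le> ?B n * norm (of_real (R n) - u * of_real (R n))"
      proof (rule norm_diff_ray_integrals_le[OF hol_h \<open>open S\<close> \<open>convex S\<close> R0])
        fix z assume "z \<in> closed_segment (complex_of_real (R n)) (u * of_real (R n))"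
        then obtain \<tau> where \<tau>: "0 \<le> \<tau>" "\<tau> \<le> 1" and z: "z = (1 - \<tau>) *\<^sub>R of_real (R n) + \<tau> *\<^sub>R (u * of_real (R n))"
          unfolding closed_segment_def by blast
        have Re: "Re z = (1 - \<tau>) * R n" and Im: "Im z = - (s * (\<tau> * R n))"
          unfolding z by (simp_all add: u_def)
        have Im': "s * Im z = - (\<tau> * R n)"
          unfolding Im using ss by (simp flip: mult.assoc)
        \<comment> \<open>This linear functional takes the value \<open>R n\<close> at both ends of
          the chord, hence on all of it. The lower bound from \<open>sector\<close> is therefore the
          same along the whole connecting path.\<close>
        have sum: "Re z - s * Im z = R n"
          unfolding Re Im' by (simp add: algebra_simps)
        have Q: "Re z \<ge> 0" "s * Im z \<le> 0"
          using \<tau> R0 unfolding Re Im' by auto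
        have nz: "norm z \<le> R n"
        proof -
          have "norm z \<le> \<bar>Re z\<bar> + \<bar>Im z\<bar>" by (rule cmod_le)
          also have "\<bar>Im z\<bar> = \<bar>s * Im z\<bar>" using s by auto
          finally show ?thesis using Q sum by simp
        qed
        have "norm (f z) \<le> C * exp (A * R n)"
          using nz C \<open>A > 0\<close> by (intro order_trans[OF growth]) (auto intro!: mult_left_mono)
        moreover have "norm (exp (- w * z)) \<le> exp (norm w * R n)"
          using nz by (intro order_trans[OF norm_exp]) (auto simp: norm_mult intro!: mult_left_mono)
        moreover have "norm (reg n z) \<le> exp (- (real (Suc n) ^ 5 / 4))"
        proof -
          \<comment> \<open>With N = n + 1, the power 3/2 of N^4 is N^6. Dividing by the 4 of
            \<open>sector\<close> and the N of \<open>reg\<close> leaves N^5 / 4 in the exponent,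
            against K N^4 from \<open>f\<close> and the kernel.\<close>
          have "sqrt (R n) = real (Suc n) ^ 2"
            by (rule real_sqrt_unique) (auto simp: R_def simp flip: power_mult)
          then have "R n * sqrt (R n) / 4 = real (Suc n) * (real (Suc n) ^ 5 / 4)"
            by (simp add: R_def power_numeral_reduce del: of_nat_Suc)
          then have "real (Suc n) * (real (Suc n) ^ 5 / 4) \<le> Re (P z)"
            using sector[OF Q] sum by simp
          then have "real (Suc n) ^ 5 / 4 \<le> Re (P z) / real (Suc n)"
            by (simp add: pos_le_divide_eq mult.commute del: of_nat_Suc)
          moreover have "Re (- P z / of_nat (Suc n)) = - (Re (P z) / real (Suc n))"
            by (simp del: of_nat_Suc)
          ultimately show ?thesis
            unfolding reg_def norm_exp_eq_Re by simp
        qed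
        ultimately have "norm (h n z) \<le> C * exp (A * R n) * exp (norm w * R n) * exp (- (real (Suc n) ^ 5 / 4))"
          unfolding h_def norm_mult using C by (intro mult_mono) auto
        also have "\<dots> = ?B n"
          by (simp add: K_def R_def distrib_right exp_add)
        finally show "norm (h n z) \<le> ?B n" .
      next
        show "of_real x \<in> S" "u * of_real x \<in> S" if "x \<in> {0..R n}" for x
          using that ss by (auto simp: S_eq u_def simp flip: mult.assoc)
      qed
      also have "\<dots> \<le> ?B n * (2 * real (Suc n) ^ 4)"
      proof (rule mult_left_mono)
        have "norm (of_real (R n) - u * of_real (R n)) \<le> norm (complex_of_real (R n)) + norm (u * of_real (R n))"
          by (rule norm_triangle_ineq4)
        also have "\<dots> = 2 * R n"
          using s R0 by (auto simp: u_def norm_mult)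
        finally show "norm (of_real (R n) - u * of_real (R n)) \<le> 2 * real (Suc n) ^ 4"
          by (simp add: R_def)
      qed (use C in auto)
      finally show "norm ((LBINT x:{0..R n}. h n (of_real x)) - u * (LBINT x:{0..R n}. h n (u * of_real x)))
        \<le> ?B n * (2 * real (Suc n) ^ 4)" .
    qed
    have "K > 0" using \<open>A > 0\<close> by (simp add: K_def add_pos_nonneg)
    then have "(\<lambda>n. exp (K * real (Suc n) ^ 4) * exp (- (real (Suc n) ^ 5 / 4)) * (2 * real (Suc n) ^ 4)) \<longlonglongrightarrow> 0"
      by real_asymp
    then show "(\<lambda>n. ?B n * (2 * real (Suc n) ^ 4)) \<longlonglongrightarrow> 0"
      using tendsto_mult_right_zero[of "\<lambda>n. exp (K * real (Suc n) ^ 4) * exp (- (real (Suc n) ^ 5 / 4)) * (2 * real (Suc n) ^ 4)"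
          sequentially C] by (simp only: mult.assoc)
  qed
  moreover have "(\<lambda>n. (LBINT x:{0..R n}. h n (of_real x)) - u * (LBINT x:{0..R n}. h n (u * of_real x))) \<longlonglongrightarrow>
      (LBINT x:{0..}. f (of_real x) * exp (- w * of_real x)) -
      u * (LBINT y:{0..}. f (u * of_real y) * exp (- w * (u * of_real y)))"
    by (rule tendsto_diff[OF lim1 tendsto_mult_left[OF lim2]])
  ultimately have "0 = (LBINT x:{0..}. f (of_real x) * exp (- w * of_real x)) -
      u * (LBINT y:{0..}. f (u * of_real y) * exp (- w * (u * of_real y)))"
    by (rule LIMSEQ_unique)
  then have eq: "(LBINT x:{0..}. f (of_real x) * exp (- w * of_real x)) =
      u * (LBINT y:{0..}. f (u * of_real y) * exp (- w * (u * of_real y)))"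
    by (rule eq_iff_diff_eq_0[THEN iffD2, OF sym])
  have "- w * (u * complex_of_real y) = Complex (- t) (s * \<epsilon>) * of_real y" for y
    using arg_cong[OF uw, of "\<lambda>c. - c * of_real y"] by (simp only: minus_minus mult_minus_left mult.assoc)
  from eq[unfolded this] show ?thesis
    by (simp only: w_def u_def)
qed

section \<open>Vanishing of the damped transforms beyond the type\<close>

lemma integrable_exp_abs:
  assumes "c > (0::real)"
  shows "integrable lborel (\<lambda>x::real. exp (- (c * \<bar>x\<bar>)))"
proof -
  let ?e = "\<lambda>x. indicator {0..} x *\<^sub>R exp (- (c * x))"
  have e: "integrable lborel ?e"
    using integrable_exp_decay[OF assms] unfolding set_integrable_def .
  then have "integrable lborel (\<lambda>x. ?e (0 + (-1) * x))"
    by (intro lborel_integrable_real_affine) auto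
  then have "integrable lborel (\<lambda>x. ?e x + ?e (0 + (-1) * x))"
    by (intro Bochner_Integration.integrable_add e)
  then show ?thesis
    by (rule Bochner_Integration.integrable_bound) (auto simp: indicator_def)
qed

lemma integrable_mult_L2:
  fixes f g :: "'a \<Rightarrow> complex"
  assumes [measurable]: "f \<in> borel_measurable M" "g \<in> borel_measurable M"
    and f: "integrable M (\<lambda>x. (norm (f x))\<^sup>2)" and g: "integrable M (\<lambda>x. (norm (g x))\<^sup>2)"
  shows "integrable M (\<lambda>x. f x * g x)"
proof (rule Bochner_Integration.integrable_bound)
  show "integrable M (\<lambda>x. (norm (f x))\<^sup>2 + (norm (g x))\<^sup>2)"
    by (intro Bochner_Integration.integrable_add f g)
  have "a * b \<le> a\<^sup>2 + b\<^sup>2" for a b :: real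
  proof -
    have "0 \<le> (a - b)\<^sup>2 + a\<^sup>2 + b\<^sup>2" by simp
    then show ?thesis by (simp add: power2_diff)
  qed
  then show "AE x in M. norm (f x * g x) \<le> norm ((norm (f x))\<^sup>2 + (norm (g x))\<^sup>2)"
    by (simp add: norm_mult)
qed measurable

lemma integrable_damped:
  fixes f :: "real \<Rightarrow> complex"
  assumes [measurable]: "f \<in> borel_measurable borel"
    and f: "integrable lborel (\<lambda>x. (norm (f x))\<^sup>2)" and \<epsilon>: "\<epsilon> > 0"
  shows "integrable lborel (\<lambda>x. f x * of_real (exp (- (\<epsilon> * \<bar>x\<bar>))))"
proof (rule integrable_mult_L2[OF _ _ f])
  have "(norm (complex_of_real (exp (- (\<epsilon> * \<bar>x\<bar>)))))\<^sup>2 = exp (- ((2 * \<epsilon>) * \<bar>x\<bar>))" for x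
    by (simp add: mult.assoc flip: exp_double)
  then show "integrable lborel (\<lambda>x. (norm (complex_of_real (exp (- (\<epsilon> * \<bar>x\<bar>)))))\<^sup>2)"
    using integrable_exp_abs[of "2 * \<epsilon>"] \<epsilon> by simp
qed measurable

lemma integral_split_at_0:
  fixes F :: "real \<Rightarrow> complex"
  assumes F: "integrable lborel F"
  shows "(\<integral>x. F x \<partial>lborel) = (LBINT x:{0..}. F x) + (LBINT x:{0..}. F (- x))"
proof -
  have [measurable]: "F \<in> borel_measurable borel"
    using borel_measurable_integrable[OF F] by simp
  have int: "integrable lborel (\<lambda>x. indicator S x *\<^sub>R F x)" if "S \<in> sets borel" for S
    using F that by (intro integrable_mult_indicator) auto
  have "(\<integral>x. F x \<partial>lborel) = (\<integral>x. indicator {0..} x *\<^sub>R F x + indicator {..<0} x *\<^sub>R F x \<partial>lborel)"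
    by (intro Bochner_Integration.integral_cong) (auto simp: indicator_def)
  also have "\<dots> = (\<integral>x. indicator {0..} x *\<^sub>R F x \<partial>lborel) + (\<integral>x. indicator {..<0} x *\<^sub>R F x \<partial>lborel)"
    by (intro Bochner_Integration.integral_add int) auto
  also have "(\<integral>x. indicator {..<0} x *\<^sub>R F x \<partial>lborel) = (\<integral>x. indicator {..<0} (- x) *\<^sub>R F (- x) \<partial>lborel)"
    by (subst lborel_integral_real_affine[where c = "-1" and t = 0]) auto
  also have "\<dots> = (\<integral>x. indicator {0..} x *\<^sub>R F (- x) \<partial>lborel)"
  proof (rule integral_cong_AE)
    show "AE x in lborel. indicator {..<0} (- x) *\<^sub>R F (- x) = indicator {0..} x *\<^sub>R F (- x)"
      using AE_lborel_singleton[of "0::real"] by eventually_elim (auto simp: indicator_def)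
  qed measurable
  finally show ?thesis by (simp add: set_lebesgue_integral_def)
qed

lemma fourier_damped_tendsto_0:
  fixes f :: "complex \<Rightarrow> complex" and A C \<tau> :: real and \<epsilon> :: "nat \<Rightarrow> real"
  assumes hol: "f holomorphic_on UNIV"
    and growth: "\<And>z. norm (f z) \<le> C * exp (A * norm z)"
    and A: "A > 0" and L2: "integrable lborel (\<lambda>x. (norm (f (of_real x)))\<^sup>2)"
    and \<tau>: "\<bar>\<tau>\<bar> > A" and \<epsilon>: "\<And>n. \<epsilon> n > 0" "\<epsilon> \<longlonglongrightarrow> 0"
  shows "(\<lambda>n. fourier (\<lambda>x. f (of_real x) * of_real (exp (- (\<epsilon> n * \<bar>x\<bar>)))) \<tau>) \<longlonglongrightarrow> 0"
proof -
  define t where "t = \<bar>\<tau>\<bar>"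
  \<comment> \<open>The half-axis depends on the sign of the frequency: along \<open>u * y\<close>
    the kernel exp (- i \<tau> z) becomes exp (- t y).\<close>
  define s where "s = sgn \<tau>"
  define u where "u = - \<i> * complex_of_real s"
  have s: "s = 1 \<or> s = -1" and st: "\<tau> = s * t" and t: "t > A"
    using \<tau> A by (auto simp: s_def t_def sgn_if)
  have [measurable]: "f \<in> borel_measurable borel"
    by (intro borel_measurable_continuous_onI holomorphic_on_imp_continuous_on hol)
  have C: "C \<ge> 0"
    using growth[of 0] norm_ge_zero[of "f 0"] by (simp del: norm_ge_zero)
  \<comment> \<open>Both rotated integrals are values of this function, at
    \<open>s * \<epsilon> n\<close> and at \<open>- (s * \<epsilon> n)\<close>. The modulus of the
    exponential does not depend on \<kappa>, so a single majorant gives continuity at 0.\<close>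
  define J where "J = (\<lambda>\<kappa>. LBINT y:{0..}. f (u * of_real y) * exp (Complex (- t) \<kappa> * of_real y))"
  have J: "(\<lambda>n. J (\<kappa> n)) \<longlonglongrightarrow> J 0" if \<kappa>: "\<kappa> \<longlonglongrightarrow> 0" for \<kappa> :: "nat \<Rightarrow> real"
    unfolding J_def set_lebesgue_integral_def
  proof (rule integral_dominated_convergence)
    have "set_integrable lborel {0..} (\<lambda>x. C * exp (- ((t - A) * x)))"
      using integrable_exp_decay[of "t - A"] t by (intro set_integrable_mult_right) simp
    then show "integrable lborel (\<lambda>x. indicator {0..} x *\<^sub>R (C * exp (- ((t - A) * x))))"
      by (simp only: set_integrable_def)
    show "AE y in lborel. (\<lambda>n. indicator {0..} y *\<^sub>R (f (u * of_real y) * exp (Complex (- t) (\<kappa> n) * of_real y))) \<longlonglongrightarrow>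
        indicator {0..} y *\<^sub>R (f (u * of_real y) * exp (Complex (- t) 0 * of_real y))"
      by (intro AE_I2 tendsto_intros \<kappa>)
    show "AE x in lborel. norm (indicator {0..} x *\<^sub>R (f (u * of_real x) * exp (Complex (- t) (\<kappa> n) * of_real x)))
        \<le> indicator {0..} x *\<^sub>R (C * exp (- ((t - A) * x)))" for n
    proof (intro AE_I2)
      fix x :: real
      have "norm (f (u * of_real x)) * exp (- (t * x)) \<le> C * exp (A * x) * exp (- (t * x))" if "x \<ge> 0"
        using growth[of "u * of_real x"] s that by (auto simp: norm_mult u_def intro!: mult_right_mono)
      also have "C * exp (A * x) * exp (- (t * x)) = C * exp (- ((t - A) * x))"
        by (simp add: algebra_simps flip: exp_add)
      finally show "norm (indicator {0..} x *\<^sub>R (f (u * of_real x) * exp (Complex (- t) (\<kappa> n) * of_real x)))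
        \<le> indicator {0..} x *\<^sub>R (C * exp (- ((t - A) * x)))"
        by (auto simp: norm_mult indicator_def)
    qed
  qed measurable
  have eq: "fourier (\<lambda>x. f (of_real x) * of_real (exp (- (\<epsilon> n * \<bar>x\<bar>)))) \<tau> = u * J (s * \<epsilon> n) - u * J (- (s * \<epsilon> n))" for n
  proof -
    let ?g = "\<lambda>x. f (of_real x) * of_real (exp (- (\<epsilon> n * \<bar>x\<bar>)))"
    let ?F = "\<lambda>x. ?g x * cis (- (\<tau> * x))"
    have g: "integrable lborel ?g"
      by (rule integrable_damped[OF _ L2 \<epsilon>(1)]) measurable
    then have g': "integrable lborel (\<lambda>x. ?g (0 + (-1) * x))"
      by (intro lborel_integrable_real_affine) auto
    have half: "set_integrable lborel {0..} (\<lambda>x. h x * of_real (exp (- (\<epsilon> n * x))))"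
      if "integrable lborel (\<lambda>x. h x * of_real (exp (- (\<epsilon> n * \<bar>x\<bar>))))" for h :: "real \<Rightarrow> complex"
    proof -
      have "set_integrable lborel {0..} (\<lambda>x. h x * of_real (exp (- (\<epsilon> n * \<bar>x\<bar>))))"
        unfolding set_integrable_def using that by (intro integrable_mult_indicator) auto
      then show ?thesis
        by (subst set_integrable_cong[OF refl refl]) auto
    qed
    have exp_cis: "of_real (exp (- (\<epsilon> n * x))) * cis (- (c * x)) = exp (- Complex (\<epsilon> n) c * of_real x)" for x c
      by (simp add: exp_eq_polar cis_cnj)
    have F: "integrable lborel ?F"
      using integrable_times_cis[OF g, of "- \<tau>"] by simp
    have "fourier ?g \<tau> = (LBINT x:{0..}. ?F x) + (LBINT x:{0..}. ?F (- x))"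
      unfolding fourier_def by (rule integral_split_at_0[OF F])
    also have "(LBINT x:{0..}. ?F x) = (LBINT x:{0..}. f (of_real x) * exp (- Complex (\<epsilon> n) (s * t) * of_real x))"
      unfolding exp_cis[symmetric] by (intro set_lebesgue_integral_cong) (auto simp: st)
    also have "\<dots> = u * J (s * \<epsilon> n)"
      unfolding u_def J_def
      by (rule rotate_laplace_ray[OF hol growth A s t \<epsilon>(1) half[OF g]])
    also have "(LBINT x:{0..}. ?F (- x)) = (LBINT x:{0..}. f (- of_real x) * exp (- Complex (\<epsilon> n) (- s * t) * of_real x))"
      unfolding exp_cis[symmetric] by (intro set_lebesgue_integral_cong) (auto simp: st)
    \<comment> \<open>The reflected left half-line is the same problem for \<open>f (- z)\<close>
      with sign \<open>- s\<close>. The sign changes in the argument and in the direction cancel, so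
      \<open>f\<close> is again evaluated along \<open>u * y\<close>, while the prefactor becomes
      \<open>- u\<close>.\<close>
    also have "\<dots> = - \<i> * of_real (- s) * (LBINT y:{0..}. f (- (- \<i> * of_real (- s) * of_real y)) * exp (Complex (- t) (- s * \<epsilon> n) * of_real y))"
    proof (rule rotate_laplace_ray[OF _ _ A _ t \<epsilon>(1)])
      show "(\<lambda>z. f (- z)) holomorphic_on UNIV"
        using holomorphic_on_compose_gen[OF holomorphic_on_minus[OF holomorphic_on_ident] hol, of UNIV]
        by (simp add: o_def)
      show "norm (f (- z)) \<le> C * exp (A * norm z)" for z
        using growth[of "- z"] by simp
      show "set_integrable lborel {0..} (\<lambda>x. f (- complex_of_real x) * complex_of_real (exp (- (\<epsilon> n * x))))"
        using g' by (intro half) simp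
    qed (use s in auto)
    also have "\<dots> = - u * J (- (s * \<epsilon> n))"
      unfolding u_def J_def by simp
    finally show ?thesis by simp
  qed
  have "(\<lambda>n. s * \<epsilon> n) \<longlonglongrightarrow> 0" "(\<lambda>n. - (s * \<epsilon> n)) \<longlonglongrightarrow> 0"
    using tendsto_mult_right_zero[OF \<epsilon>(2), of s] tendsto_minus by force+
  then have "(\<lambda>n. u * J (s * \<epsilon> n) - u * J (- (s * \<epsilon> n))) \<longlonglongrightarrow> u * J 0 - u * J 0"
    by (intro tendsto_diff tendsto_mult_left J)
  then show ?thesis by (simp only: eq diff_self)
qed

section \<open>The Paley--Wiener theorem\<close>

text \<open>Where \<phi> does not vanish, \<bar>t\<bar> \<le> A, so the k-th term of the exponential
  series is dominated by \<open>norm (\<phi> t) * ((A * norm z) ^ k / fact k)\<close>. Summation and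
  integration may be exchanged, and the integral is a power series converging everywhere.\<close>

lemma entire_integral_exp:
  fixes \<phi> :: "real \<Rightarrow> complex"
  assumes \<phi>: "integrable lborel \<phi>" and supp: "\<And>t. \<bar>t\<bar> > A \<Longrightarrow> \<phi> t = 0" and A: "A \<ge> 0"
  shows "(\<lambda>z. \<integral>t. \<phi> t * exp (\<i> * of_real t * z) \<partial>lborel) holomorphic_on UNIV"
proof -
  define G where "G = (\<lambda>z. \<integral>t. \<phi> t * exp (\<i> * of_real t * z) \<partial>lborel)"
  have [measurable]: "\<phi> \<in> borel_measurable borel"
    using borel_measurable_integrable[OF \<phi>] by simp
  define a where "a = (\<lambda>k. \<integral>t. \<phi> t * ((\<i> * of_real t) ^ k / fact k) \<partial>lborel)"
  have sums: "(\<lambda>k. a k * z ^ k) sums G z" for z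
  proof -
    let ?f = "\<lambda>k t. \<phi> t * ((\<i> * of_real t * z) ^ k / fact k)"
    have bound: "norm (?f k t) \<le> norm (\<phi> t) * ((A * norm z) ^ k / fact k)" for k t
    proof (cases "\<bar>t\<bar> > A")
      case False
      then have "norm (\<i> * of_real t * z) \<le> A * norm z"
        by (auto simp: norm_mult intro: mult_right_mono)
      then have "norm (\<i> * of_real t * z) ^ k / fact k \<le> (A * norm z) ^ k / fact k"
        by (intro divide_right_mono power_mono) auto
      then show ?thesis
        unfolding norm_mult[of "\<phi> t"] by (intro mult_left_mono) (simp_all add: norm_divide norm_power)
    qed (simp add: supp)
    have bint: "integrable lborel (\<lambda>t. norm (\<phi> t) * ((A * norm z) ^ k / fact k))" for k
      using \<phi> by (intro integrable_mult_left integrable_norm)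
    have fint: "integrable lborel (?f k)" for k
    proof (rule Bochner_Integration.integrable_bound[OF bint])
      show "AE t in lborel. norm (?f k t) \<le> norm (norm (\<phi> t) * ((A * norm z) ^ k / fact k))"
        using bound[where k = k] A by (intro AE_I2) simp
    qed measurable
    have exp_summable: "summable (\<lambda>k. c * ((A * norm z) ^ k / fact k))" for c
      using summable_exp_generic[of "A * norm z"]
      by (intro summable_mult) (simp add: divide_inverse mult.commute)
    have "(\<lambda>k. integral\<^sup>L lborel (?f k)) sums (\<integral>t. (\<Sum>k. ?f k t) \<partial>lborel)"
    proof (rule sums_integral[OF fint])
      show "AE t in lborel. summable (\<lambda>k. norm (?f k t))"
      proof (intro AE_I2)
        fix t
        show "summable (\<lambda>k. norm (?f k t))"
          by (rule summable_comparison_test'[OF exp_summable[of "norm (\<phi> t)"], where N = 0]) (use bound in auto)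
      qed
      show "summable (\<lambda>k. \<integral>t. norm (?f k t) \<partial>lborel)"
      proof (rule summable_comparison_test'[OF exp_summable[of "\<integral>t. norm (\<phi> t) \<partial>lborel"], where N = 0])
        fix k
        have "(\<integral>t. norm (?f k t) \<partial>lborel) \<le> (\<integral>t. norm (\<phi> t) * ((A * norm z) ^ k / fact k) \<partial>lborel)"
          by (intro integral_mono integrable_norm fint bint bound)
        then show "norm (\<integral>t. norm (?f k t) \<partial>lborel) \<le> (\<integral>t. norm (\<phi> t) \<partial>lborel) * ((A * norm z) ^ k / fact k)"
          by (simp add: integral_nonneg_AE)
      qed
    qed
    moreover have "integral\<^sup>L lborel (?f k) = a k * z ^ k" for k
      unfolding a_def by (subst integral_mult_left_zero[symmetric])
        (simp add: power_mult_distrib mult_ac)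
    moreover have "(\<Sum>k. ?f k t) = \<phi> t * exp (\<i> * of_real t * z)" for t
    proof -
      have "(\<lambda>k. \<phi> t * ((\<i> * of_real t * z) ^ k / fact k)) sums (\<phi> t * exp (\<i> * of_real t * z))"
        using exp_converges[of "\<i> * of_real t * z"]
        by (intro sums_mult) (simp add: scaleR_conv_of_real divide_inverse mult.commute)
      then show ?thesis by (rule sums_unique[symmetric])
    qed
    ultimately show ?thesis by (simp add: G_def)
  qed
  have "G holomorphic_on ball 0 (norm z + 1)" for z :: complex
    using sums by (intro power_series_holomorphic[where a = a]) simp
  then have "G field_differentiable at z" for z
    using holomorphic_on_imp_differentiable_at[of G "ball 0 (norm z + 1)" z] by simp
  then have "G holomorphic_on UNIV"
    by (auto simp: holomorphic_on_def field_differentiable_at_within)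
  then show ?thesis by (simp only: G_def)
qed

text \<open>Cauchy--Schwarz against a fixed square-integrable weight. It is carried out in
  \<open>ennreal\<close>, where L^2 convergence is stated, and only the final squeeze returns to
  real numbers.\<close>

lemma tendsto_integral_mult_L2:
  fixes u :: "nat \<Rightarrow> 'a \<Rightarrow> complex"
  assumes [measurable]: "\<And>n. u n \<in> borel_measurable M" "\<phi> \<in> borel_measurable M" "w \<in> borel_measurable M"
    and u: "\<And>n. integrable M (\<lambda>x. u n x * w x)" and \<phi>: "integrable M (\<lambda>x. \<phi> x * w x)"
    and lim: "(\<lambda>n. \<integral>\<^sup>+x. ennreal ((norm (u n x - \<phi> x))\<^sup>2) \<partial>M) \<longlonglongrightarrow> 0"
    and w: "integrable M (\<lambda>x. (norm (w x))\<^sup>2)"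
  shows "(\<lambda>n. \<integral>x. u n x * w x \<partial>M) \<longlonglongrightarrow> (\<integral>x. \<phi> x * w x \<partial>M)"
proof -
  define W where "W = (\<integral>x. (norm (w x))\<^sup>2 \<partial>M)"
  have W0: "W \<ge> 0" by (simp add: W_def)
  have W: "(\<integral>\<^sup>+x. (ennreal (norm (w x)))\<^sup>2 \<partial>M) = ennreal W"
    using w by (simp add: ennreal_power nn_integral_eq_integral W_def)
  let ?d = "\<lambda>n. (\<integral>x. u n x * w x \<partial>M) - (\<integral>x. \<phi> x * w x \<partial>M)"
  have bound: "ennreal ((norm (?d n))\<^sup>2) \<le> ennreal W * (\<integral>\<^sup>+x. ennreal ((norm (u n x - \<phi> x))\<^sup>2) \<partial>M)" for n
  proof -
    have "?d n = (\<integral>x. (u n x - \<phi> x) * w x \<partial>M)"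
      using Bochner_Integration.integral_diff[OF u \<phi>, of n] by (simp add: left_diff_distrib)
    then have "ennreal (norm (?d n)) \<le> (\<integral>\<^sup>+x. ennreal (norm ((u n x - \<phi> x) * w x)) \<partial>M)"
      by (simp only: norm_integral_le_nn_integral)
    also have "\<dots> = (\<integral>\<^sup>+x. ennreal (norm (u n x - \<phi> x)) * ennreal (norm (w x)) \<partial>M)"
      by (simp add: norm_mult ennreal_mult)
    finally have "(ennreal (norm (?d n)))\<^sup>2 \<le> (\<integral>\<^sup>+x. ennreal (norm (u n x - \<phi> x)) * ennreal (norm (w x)) \<partial>M)\<^sup>2"
      by (rule power_mono) simp
    also have "\<dots> \<le> (\<integral>\<^sup>+x. (ennreal (norm (u n x - \<phi> x)))\<^sup>2 \<partial>M) * (\<integral>\<^sup>+x. (ennreal (norm (w x)))\<^sup>2 \<partial>M)"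
      by (rule Cauchy_Schwarz_nn_integral) measurable
    finally show ?thesis
      unfolding W by (simp add: ennreal_power mult.commute)
  qed
  have "(\<lambda>n. ennreal W * (\<integral>\<^sup>+x. ennreal ((norm (u n x - \<phi> x))\<^sup>2) \<partial>M)) \<longlonglongrightarrow> ennreal W * 0"
    by (intro ennreal_tendsto_cmult lim) simp
  then have lim0: "(\<lambda>n. ennreal W * (\<integral>\<^sup>+x. ennreal ((norm (u n x - \<phi> x))\<^sup>2) \<partial>M)) \<longlonglongrightarrow> 0"
    by simp
  have "(\<lambda>n. ennreal ((norm (?d n))\<^sup>2)) \<longlonglongrightarrow> 0"
    by (rule tendsto_sandwich[OF always_eventually always_eventually tendsto_const lim0])
      (use bound in simp_all)
  then have "(\<lambda>n. (norm (?d n))\<^sup>2) \<longlonglongrightarrow> 0"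
    by (simp add: ennreal_tendsto_0_iff)
  then have "(\<lambda>n. norm (?d n)) \<longlonglongrightarrow> 0"
    by (simp add: power_tendsto_0_iff)
  then show ?thesis
    by (simp add: tendsto_norm_zero_iff Lim_null[of "\<lambda>n. \<integral>x. u n x * w x \<partial>M"])
qed

text \<open>The densities concentrate at \<open>y\<close>, but \<open>f\<close> may grow
  exponentially, which the Gaussian tails have to absorb. The substitution x = y - v / \<sigma>
  fixes the density and moves the parameter into \<open>f\<close>, so that dominated convergence
  applies.\<close>

lemma tendsto_gauss_average:
  fixes f :: "real \<Rightarrow> complex"
  assumes cont: "continuous_on UNIV f" and A: "A \<ge> 0" and growth: "\<And>x. norm (f x) \<le> C * exp (A * \<bar>x\<bar>)"
  shows "(\<lambda>k. \<integral>x. f x * of_real (normal_density 0 (1 / real (Suc k)) (y - x)) \<partial>lborel) \<longlonglongrightarrow> f y"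
proof -
  have [measurable]: "f \<in> borel_measurable borel"
    by (rule borel_measurable_continuous_onI[OF cont])
  have C: "C \<ge> 0"
    using growth[of 0] norm_ge_zero[of "f 0"] by (simp del: norm_ge_zero)
  have subst: "(\<integral>x. f x * of_real (normal_density 0 (1 / \<sigma>) (y - x)) \<partial>lborel) =
      (\<integral>v. f (y - v / \<sigma>) * of_real (std_normal_density v) \<partial>lborel)" if \<sigma>: "\<sigma> > 0" for \<sigma>
  proof -
    have "normal_density 0 (1 / \<sigma>) (v / \<sigma>) / \<sigma> = std_normal_density v" for v
      using \<sigma> by (simp add: normal_density_def power_divide real_sqrt_divide real_sqrt_mult)
    then have dens: "complex_of_real (normal_density 0 (1 / \<sigma>) (v / \<sigma>)) / of_real \<sigma> = of_real (std_normal_density v)" for v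
      by (metis of_real_divide)
    have "(\<integral>x. f x * of_real (normal_density 0 (1 / \<sigma>) (y - x)) \<partial>lborel) =
        \<bar>- (1 / \<sigma>)\<bar> *\<^sub>R (\<integral>v. f (y + - (1 / \<sigma>) * v) * of_real (normal_density 0 (1 / \<sigma>) (y - (y + - (1 / \<sigma>) * v))) \<partial>lborel)"
      using \<sigma> by (intro lborel_integral_real_affine) simp
    also have "\<dots> = (\<integral>v. \<bar>- (1 / \<sigma>)\<bar> *\<^sub>R (f (y + - (1 / \<sigma>) * v) * of_real (normal_density 0 (1 / \<sigma>) (y - (y + - (1 / \<sigma>) * v)))) \<partial>lborel)"
      by simp
    also have "\<dots> = (\<integral>v. f (y - v / \<sigma>) * of_real (std_normal_density v) \<partial>lborel)"
      using \<sigma> unfolding dens[symmetric]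
      by (intro Bochner_Integration.integral_cong refl) (simp add: scaleR_conv_of_real)
    finally show ?thesis .
  qed
  have "(\<lambda>k. \<integral>v. f (y - v / real (Suc k)) * of_real (std_normal_density v) \<partial>lborel) \<longlonglongrightarrow>
      (\<integral>v. f y * of_real (std_normal_density v) \<partial>lborel)"
  proof (rule integral_dominated_convergence)
    \<comment> \<open>Half of the exponent v^2 / 2 is spent on the growth: A \<bar>v\<bar> \<le> v^2
      / 4 + A^2. The remaining v^2 / 4 is written with \<open>sqrt 2\<close> to match the form of
      \<open>integrable_gauss\<close>.\<close>
    let ?b = "\<lambda>v. C * exp (A * \<bar>y\<bar> + A\<^sup>2) * exp (- (v\<^sup>2 / (2 * (sqrt 2)\<^sup>2)))"
    show "integrable lborel ?b"
      by (intro integrable_mult_right integrable_gauss) simp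
    show "AE v in lborel. (\<lambda>k. f (y - v / real (Suc k)) * of_real (std_normal_density v)) \<longlonglongrightarrow> f y * of_real (std_normal_density v)"
    proof (intro AE_I2 tendsto_mult tendsto_const)
      fix v :: real
      have "(\<lambda>k. y - v / real (Suc k)) \<longlonglongrightarrow> y" by real_asymp
      then show "(\<lambda>k. f (y - v / real (Suc k))) \<longlonglongrightarrow> f y"
        using cont by (intro continuous_on_tendsto_compose[OF cont]) auto
    qed
    show "AE v in lborel. norm (f (y - v / real (Suc k)) * of_real (std_normal_density v)) \<le> ?b v" for k
    proof (intro AE_I2)
      fix v :: real
      have "\<bar>v / real (Suc k)\<bar> \<le> \<bar>v\<bar>"
        by (simp add: divide_le_eq_1 mult_left_le field_simps)
      then have "\<bar>y - v / real (Suc k)\<bar> \<le> \<bar>y\<bar> + \<bar>v\<bar>" by linarith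
      then have 1: "norm (f (y - v / real (Suc k))) \<le> C * exp (A * (\<bar>y\<bar> + \<bar>v\<bar>))"
        using A C by (intro order_trans[OF growth]) (auto intro!: mult_left_mono)
      have "1 / sqrt (2 * pi) \<le> 1"
        using pi_gt3 by (simp add: divide_le_eq_1)
      then have 2: "std_normal_density v \<le> exp (- v\<^sup>2 / 2)"
        unfolding std_normal_density_def by (intro mult_left_le_one_le) auto
      have "0 \<le> (\<bar>v\<bar> / 2 - A)\<^sup>2" by simp
      then have "A * \<bar>v\<bar> \<le> v\<^sup>2 / 4 + A\<^sup>2" by (simp add: power2_diff power_divide field_simps)
      then have 3: "A * (\<bar>y\<bar> + \<bar>v\<bar>) + - v\<^sup>2 / 2 \<le> A * \<bar>y\<bar> + A\<^sup>2 + - (v\<^sup>2 / (2 * (sqrt 2)\<^sup>2))"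
        by (simp add: distrib_left)
      have "norm (f (y - v / real (Suc k)) * of_real (std_normal_density v)) \<le> (C * exp (A * (\<bar>y\<bar> + \<bar>v\<bar>))) * exp (- v\<^sup>2 / 2)"
        unfolding norm_mult using 1 2 C by (intro mult_mono) auto
      also have "\<dots> = C * exp (A * (\<bar>y\<bar> + \<bar>v\<bar>) + - v\<^sup>2 / 2)"
        by (simp only: exp_add mult.assoc)
      also have "\<dots> \<le> C * exp (A * \<bar>y\<bar> + A\<^sup>2 + - (v\<^sup>2 / (2 * (sqrt 2)\<^sup>2)))"
        using 3 C by (intro mult_left_mono) auto
      also have "\<dots> = ?b v"
        by (simp only: exp_add mult.assoc)
      finally show "norm (f (y - v / real (Suc k)) * of_real (std_normal_density v)) \<le> ?b v" .
    qed
  qed measurable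
  also have "(\<integral>v. f y * of_real (std_normal_density v) \<partial>lborel) = f y * of_real (\<integral>v. std_normal_density v \<partial>lborel)"
    by (simp only: integral_mult_right_zero integral_complex_of_real)
  also have "(\<integral>v. std_normal_density v \<partial>lborel) = 1"
    by simp
  finally show ?thesis
    by (simp add: subst del: of_nat_Suc)
qed

lemma norm_diff_square_le: "(norm (a - b))\<^sup>2 \<le> 2 * (norm (a - c))\<^sup>2 + 2 * (norm (b - c))\<^sup>2"
  for a b c :: "'a::real_normed_vector"
proof -
  have "norm (a - b) \<le> norm (a - c) + norm (b - c)"
    using norm_triangle_ineq4[of "a - c" "b - c"] by simp
  then have "(norm (a - b))\<^sup>2 \<le> (norm (a - c) + norm (b - c))\<^sup>2"
    by (intro power_mono) auto
  also have "\<dots> \<le> 2 * (norm (a - c))\<^sup>2 + 2 * (norm (b - c))\<^sup>2"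
    using zero_le_power2[of "norm (a - c) - norm (b - c)"] by (simp add: power2_sum power2_diff)
  finally show ?thesis .
qed

theorem Paley_Wiener:
  fixes f :: "complex \<Rightarrow> complex" and A C :: real
  assumes hol: "f holomorphic_on UNIV"
    and growth: "\<And>z. norm (f z) \<le> C * exp (A * norm z)"
    and A: "A > 0" and L2: "integrable lborel (\<lambda>x. (norm (f (of_real x)))\<^sup>2)"
  obtains \<phi> :: "real \<Rightarrow> complex" where "\<phi> \<in> borel_measurable borel"
    "integrable lborel (\<lambda>t. (norm (\<phi> t))\<^sup>2)" "\<And>t. t \<notin> {-A<..<A} \<Longrightarrow> \<phi> t = 0"
    "\<And>z. f z = (\<integral>t. \<phi> t * exp (\<i> * of_real t * z) \<partial>lborel)"
proof -
  define fr where "fr = (\<lambda>x::real. f (of_real x))"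
  define g where "g = (\<lambda>n x. fr x * of_real (exp (- (1 / real (Suc n) * \<bar>x\<bar>))))"
  have [measurable]: "f \<in> borel_measurable borel"
    by (intro borel_measurable_continuous_onI holomorphic_on_imp_continuous_on hol)
  have [measurable]: "fr \<in> borel_measurable borel"
    unfolding fr_def by measurable
  have [measurable]: "g n \<in> borel_measurable borel" for n
    unfolding g_def by measurable
  have C: "C \<ge> 0"
    using growth[of 0] norm_ge_zero[of "f 0"] by (simp del: norm_ge_zero)
  have L2': "integrable lborel (\<lambda>x. (norm (fr x))\<^sup>2)"
    using L2 by (simp add: fr_def)
  have g: "integrable lborel (g n)" for n
    unfolding g_def by (rule integrable_damped[OF _ L2']) auto
  have g_le: "norm (g n x) \<le> norm (fr x)" for n x
    by (simp add: g_def norm_mult mult_left_le)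
  have g_lim: "(\<lambda>n. g n x) \<longlonglongrightarrow> fr x" for x
  proof -
    have "(\<lambda>n. exp (- (1 / real (Suc n) * \<bar>x\<bar>))) \<longlonglongrightarrow> 1" by real_asymp
    then have "(\<lambda>n. g n x) \<longlonglongrightarrow> fr x * of_real 1"
      unfolding g_def by (intro tendsto_intros)
    then show ?thesis by simp
  qed
  define D where "D = (\<lambda>n. \<integral>x. (norm (g n x - fr x))\<^sup>2 \<partial>lborel)"
  have diff_le: "(norm (g n x - fr x))\<^sup>2 \<le> 4 * (norm (fr x))\<^sup>2" for n x
  proof -
    have "(norm (g n x))\<^sup>2 \<le> (norm (fr x))\<^sup>2"
      by (intro power_mono g_le) auto
    then show ?thesis
      using norm_diff_square_le[of "g n x" "fr x" 0] unfolding diff_0_right by linarith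
  qed
  have D_int: "integrable lborel (\<lambda>x. (norm (g n x - fr x))\<^sup>2)" for n
  proof (rule Bochner_Integration.integrable_bound)
    show "integrable lborel (\<lambda>x. 4 * (norm (fr x))\<^sup>2)"
      using L2' by (intro integrable_mult_right) simp
  qed (use diff_le in auto)
  have D_nn: "(\<integral>\<^sup>+x. ennreal ((norm (g n x - fr x))\<^sup>2) \<partial>lborel) = ennreal (D n)" for n
    unfolding D_def by (intro nn_integral_eq_integral D_int) auto
  have D0: "D n \<ge> 0" for n by (simp add: D_def)
  have D_lim: "D \<longlonglongrightarrow> 0"
  proof -
    have "D \<longlonglongrightarrow> (\<integral>x. 0 \<partial>(lborel :: real measure))"
      unfolding D_def
    proof (rule integral_dominated_convergence)
      show "integrable lborel (\<lambda>x. 4 * (norm (fr x))\<^sup>2)"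
        using L2' by (intro integrable_mult_right) simp
      show "AE x in lborel. (\<lambda>n. (norm (g n x - fr x))\<^sup>2) \<longlonglongrightarrow> 0"
      proof (intro AE_I2)
        fix x
        have "(\<lambda>n. (norm (g n x - fr x))\<^sup>2) \<longlonglongrightarrow> (norm (fr x - fr x))\<^sup>2"
          by (intro tendsto_intros g_lim)
        then show "(\<lambda>n. (norm (g n x - fr x))\<^sup>2) \<longlonglongrightarrow> 0" by simp
      qed
    qed (use diff_le in auto)
    then show ?thesis by simp
  qed
  have Cauchy: "\<exists>N. \<forall>m\<ge>N. \<forall>n\<ge>N.
      (\<integral>\<^sup>+t. ennreal ((norm (fourier (g m) t - fourier (g n) t))\<^sup>2) \<partial>lborel) \<le> ennreal e" if e: "e > 0" for e
  proof -
    \<comment> \<open>8 \<pi> is the 2 \<pi> of the L^2 bound, times 2 from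
      \<open>norm_diff_square_le\<close>, times 2 for the two terms.\<close>
    have "eventually (\<lambda>n. D n < e / (8 * pi)) sequentially"
      using e by (intro order_tendstoD(2)[OF D_lim]) simp
    then obtain N where N: "\<And>n. n \<ge> N \<Longrightarrow> D n < e / (8 * pi)"
      by (auto simp: eventually_sequentially)
    have "(\<integral>\<^sup>+t. ennreal ((norm (fourier (g m) t - fourier (g n) t))\<^sup>2) \<partial>lborel) \<le> ennreal e"
      if mn: "m \<ge> N" "n \<ge> N" for m n
    proof -
      have lin: "fourier (g m) t - fourier (g n) t = fourier (\<lambda>x. g m x - g n x) t" for t
        using integrable_times_cis[OF g, of m "-t"] integrable_times_cis[OF g, of n "-t"]
        unfolding fourier_def by (simp add: left_diff_distrib)
      have "(\<integral>\<^sup>+t. ennreal ((norm (fourier (g m) t - fourier (g n) t))\<^sup>2) \<partial>lborel) \<le>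
          ennreal (2 * pi) * (\<integral>\<^sup>+x. ennreal ((norm (g m x - g n x))\<^sup>2) \<partial>lborel)"
        unfolding lin by (intro nn_integral_fourier_le Bochner_Integration.integrable_diff g)
      also have "(\<integral>\<^sup>+x. ennreal ((norm (g m x - g n x))\<^sup>2) \<partial>lborel) \<le>
          (\<integral>\<^sup>+x. 2 * ennreal ((norm (g m x - fr x))\<^sup>2) + 2 * ennreal ((norm (g n x - fr x))\<^sup>2) \<partial>lborel)"
      proof (intro nn_integral_mono)
        fix x
        show "ennreal ((norm (g m x - g n x))\<^sup>2) \<le>
            2 * ennreal ((norm (g m x - fr x))\<^sup>2) + 2 * ennreal ((norm (g n x - fr x))\<^sup>2)"
          using ennreal_leI[OF norm_diff_square_le[of "g m x" "g n x" "fr x"]]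
          by (simp add: ennreal_mult)
      qed
      also have "\<dots> = 2 * ennreal (D m) + 2 * ennreal (D n)"
        by (simp add: nn_integral_add nn_integral_cmult D_nn)
      also have "ennreal (2 * pi) * \<dots> = ennreal (2 * pi * (2 * D m + 2 * D n))"
        using D0 by (simp add: ennreal_mult)
      also have "\<dots> \<le> ennreal e"
        using N[OF mn(1)] N[OF mn(2)] by (intro ennreal_leI) (simp add: field_simps)
      finally show ?thesis by (simp add: mult_left_mono)
    qed
    then show ?thesis by blast
  qed
  have meas: "fourier (g n) \<in> borel_measurable lborel" for n
    by measurable
  obtain \<psi> r where \<psi>[measurable]: "\<psi> \<in> borel_measurable lborel" and r: "strict_mono r"
    and AE_lim: "AE t in lborel. (\<lambda>k. fourier (g (r k)) t) \<longlonglongrightarrow> \<psi> t"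
    and \<psi>_lim: "(\<lambda>n. \<integral>\<^sup>+t. ennreal ((norm (fourier (g n) t - \<psi> t))\<^sup>2) \<partial>lborel) \<longlonglongrightarrow> 0"
    by (rule L2_complete[of "\<lambda>n. fourier (g n)" lborel, OF meas Cauchy])
  \<comment> \<open>Cutting off makes the support condition hold everywhere and not just almost
    everywhere. The decay at frequencies beyond \<open>A\<close> leaves the endpoints open, but they
    form a null set.\<close>
  define \<phi> where "\<phi> = (\<lambda>t. \<psi> t * indicator {-A<..<A} t)"
  have [measurable]: "\<phi> \<in> borel_measurable borel"
    using \<psi> unfolding \<phi>_def by measurable
  have supp: "\<phi> t = 0" if "t \<notin> {-A<..<A}" for t
    using that by (auto simp: \<phi>_def)
  have AE_\<phi>: "AE t in lborel. \<psi> t = \<phi> t"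
    using AE_lim AE_lborel_singleton[of A] AE_lborel_singleton[of "-A"]
  proof eventually_elim
    fix t assume lim: "(\<lambda>k. fourier (g (r k)) t) \<longlonglongrightarrow> \<psi> t" and t: "t \<noteq> A" "t \<noteq> - A"
    show "\<psi> t = \<phi> t"
    proof (cases "\<bar>t\<bar> < A")
      case False
      then have "\<bar>t\<bar> > A" using t by auto
      have "(\<lambda>n. fourier (g n) t) \<longlonglongrightarrow> 0"
        unfolding g_def fr_def
        by (rule fourier_damped_tendsto_0[OF hol growth A L2 \<open>\<bar>t\<bar> > A\<close>]) (simp, real_asymp)
      then have "(\<lambda>k. fourier (g (r k)) t) \<longlonglongrightarrow> 0"
        using LIMSEQ_subseq_LIMSEQ[OF _ r] by (force simp: o_def)
      with lim have "\<psi> t = 0" by (rule LIMSEQ_unique)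
      then show ?thesis by (simp add: \<phi>_def)
    qed (auto simp: \<phi>_def indicator_def)
  qed
  have \<phi>_lim: "(\<lambda>n. \<integral>\<^sup>+t. ennreal ((norm (fourier (g n) t - \<phi> t))\<^sup>2) \<partial>lborel) \<longlonglongrightarrow> 0"
  proof -
    have "(\<integral>\<^sup>+t. ennreal ((norm (fourier (g n) t - \<phi> t))\<^sup>2) \<partial>lborel) =
        (\<integral>\<^sup>+t. ennreal ((norm (fourier (g n) t - \<psi> t))\<^sup>2) \<partial>lborel)" for n
      using AE_\<phi> by (intro nn_integral_cong_AE) (auto elim!: eventually_mono)
    with \<psi>_lim show ?thesis by simp
  qed
  have ghat_fin: "(\<integral>\<^sup>+t. ennreal ((norm (fourier (g n) t))\<^sup>2) \<partial>lborel) < \<infinity>" for n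
  proof -
    have "(\<integral>\<^sup>+x. ennreal ((norm (g n x))\<^sup>2) \<partial>lborel) \<le> (\<integral>\<^sup>+x. ennreal ((norm (fr x))\<^sup>2) \<partial>lborel)"
      by (intro nn_integral_mono ennreal_leI power_mono g_le) auto
    also have "\<dots> < \<infinity>"
      using L2' by (simp add: nn_integral_eq_integral)
    finally have "ennreal (2 * pi) * (\<integral>\<^sup>+x. ennreal ((norm (g n x))\<^sup>2) \<partial>lborel) < \<infinity>"
      by (simp add: ennreal_mult_less_top)
    then show ?thesis
      using nn_integral_fourier_le[OF g, of n] by (rule le_less_trans[rotated])
  qed
  have ghat_L2: "integrable lborel (\<lambda>t. (norm (fourier (g n) t))\<^sup>2)" for n
    using ghat_fin[of n] by (intro integrableI_bounded) auto
  have g_L2: "integrable lborel (\<lambda>x. (norm (g n x))\<^sup>2)" for n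
    by (rule Bochner_Integration.integrable_bound[OF L2']) (auto intro!: g_le power_mono)
  have \<phi>_L2: "integrable lborel (\<lambda>t. (norm (\<phi> t))\<^sup>2)"
  proof (rule integrableI_bounded)
    obtain n where n: "(\<integral>\<^sup>+t. ennreal ((norm (fourier (g n) t - \<phi> t))\<^sup>2) \<partial>lborel) < 1"
      using order_tendstoD(2)[OF \<phi>_lim, of 1] by (auto simp: eventually_sequentially)
    have "(\<integral>\<^sup>+t. ennreal (norm ((norm (\<phi> t))\<^sup>2)) \<partial>lborel) \<le>
        (\<integral>\<^sup>+t. 2 * ennreal ((norm (fourier (g n) t - \<phi> t))\<^sup>2) + 2 * ennreal ((norm (fourier (g n) t))\<^sup>2) \<partial>lborel)"
    proof (intro nn_integral_mono)
      fix t
      show "ennreal (norm ((norm (\<phi> t))\<^sup>2)) \<le>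
          2 * ennreal ((norm (fourier (g n) t - \<phi> t))\<^sup>2) + 2 * ennreal ((norm (fourier (g n) t))\<^sup>2)"
        using ennreal_leI[OF norm_diff_square_le[of "\<phi> t" 0 "fourier (g n) t"]]
        by (simp add: ennreal_mult norm_minus_commute)
    qed
    also have "\<dots> = 2 * (\<integral>\<^sup>+t. ennreal ((norm (fourier (g n) t - \<phi> t))\<^sup>2) \<partial>lborel) +
        2 * (\<integral>\<^sup>+t. ennreal ((norm (fourier (g n) t))\<^sup>2) \<partial>lborel)"
      by (simp add: nn_integral_add nn_integral_cmult)
    also have "\<dots> < \<infinity>"
      using n ghat_fin[of n] by (auto simp: ennreal_mult_less_top intro: less_trans)
    finally show "(\<integral>\<^sup>+t. ennreal (norm ((norm (\<phi> t))\<^sup>2)) \<partial>lborel) < \<infinity>" .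
  qed measurable
  \<comment> \<open>On a bounded interval square integrability implies integrability: \<phi> is
    multiplied by the indicator of its own support, itself square integrable.\<close>
  have \<phi>_int: "integrable lborel \<phi>"
  proof -
    have "(norm (indicator {-A<..<A} t :: complex))\<^sup>2 = indicator {-A<..<A} t" for t :: real
      by (simp add: indicator_def)
    then have "integrable lborel (\<lambda>t. (norm (indicator {-A<..<A} t :: complex))\<^sup>2)"
      using A by (simp only:) (intro integrable_real_indicator, auto)
    then have "integrable lborel (\<lambda>t. \<phi> t * indicator {-A<..<A} t)"
      by (rule integrable_mult_L2[OF _ _ \<phi>_L2, rotated 2]) measurable
    moreover have "\<phi> t * indicator {-A<..<A} t = \<phi> t" for t
      by (simp add: \<phi>_def indicator_def)
    ultimately show ?thesis by simp
  qed
  \<comment> \<open>\<open>integral_fourier_gauss\<close> cannot be applied to \<open>fr\<close>,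
    which need not be integrable. It holds for each \<open>g n\<close>, and both sides pass to the
    limit because the weight on the left and the density on the right are square integrable.\<close>
  have weighted: "(\<integral>t. \<phi> t * (cis (t * y) * of_real (exp (- (t\<^sup>2 / (2 * \<sigma>\<^sup>2))))) \<partial>lborel) =
      of_real (2 * pi) * (\<integral>x. fr x * of_real (normal_density 0 (1 / \<sigma>) (y - x)) \<partial>lborel)"
    if \<sigma>: "\<sigma> > 0" for y \<sigma>
  proof -
    let ?w = "\<lambda>t. cis (t * y) * complex_of_real (exp (- (t\<^sup>2 / (2 * \<sigma>\<^sup>2))))"
    let ?N = "\<lambda>x. complex_of_real (normal_density 0 (1 / \<sigma>) (y - x))"
    have w2: "integrable lborel (\<lambda>t. (norm (?w t))\<^sup>2)"
    proof -
      have "(norm (?w t))\<^sup>2 = exp (- (t\<^sup>2 / (2 * (\<sigma> / sqrt 2)\<^sup>2)))" for t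
        by (simp add: norm_mult power_divide flip: exp_double)
      then show ?thesis
        using integrable_gauss[of "\<sigma> / sqrt 2"] \<sigma> by simp
    qed
    have N2: "integrable lborel (\<lambda>x. (norm (?N x))\<^sup>2)"
    proof -
      define c where "c = 1 / sqrt (2 * pi * (1 / \<sigma>)\<^sup>2)"
      have N_eq: "normal_density 0 (1 / \<sigma>) (y - x) = normal_density y (1 / \<sigma>) x" for x
        by (simp add: normal_density_def power2_commute)
      have le: "normal_density y (1 / \<sigma>) x \<le> c" for x
        unfolding normal_density_def c_def by (intro mult_right_le_one_le) auto
      have "integrable lborel (\<lambda>x. c * normal_density y (1 / \<sigma>) x)"
        using \<sigma> by (intro integrable_mult_right integrable_normal_density) simp
      then show ?thesis
        unfolding N_eq
        by (rule Bochner_Integration.integrable_bound)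
          (use le in \<open>auto simp: power2_eq_square abs_mult intro!: mult_mono order_trans[OF le] abs_ge_self\<close>)
    qed
    have "(\<lambda>n. \<integral>t. fourier (g n) t * ?w t \<partial>lborel) \<longlonglongrightarrow> (\<integral>t. \<phi> t * ?w t \<partial>lborel)"
      by (intro tendsto_integral_mult_L2 integrable_mult_L2 ghat_L2 \<phi>_L2 w2 \<phi>_lim) measurable
    moreover have "(\<lambda>n. of_real (2 * pi) * (\<integral>x. g n x * ?N x \<partial>lborel)) \<longlonglongrightarrow> of_real (2 * pi) * (\<integral>x. fr x * ?N x \<partial>lborel)"
    proof (intro tendsto_mult_left tendsto_integral_mult_L2 integrable_mult_L2 g_L2 L2' N2)
      show "(\<lambda>n. \<integral>\<^sup>+x. ennreal ((norm (g n x - fr x))\<^sup>2) \<partial>lborel) \<longlonglongrightarrow> 0"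
        unfolding D_nn using D_lim D0 by (simp add: ennreal_tendsto_0_iff)
    qed measurable
    ultimately show ?thesis
      unfolding integral_fourier_gauss[OF g \<sigma>] by (rule LIMSEQ_unique)
  qed
  \<comment> \<open>Here \<sigma> = k + 1 tends to infinity: on the left the weight flattens to 1
    under the majorant \<open>norm (\<phi> t)\<close>, while on the right the density of width 1 /
    \<sigma> reproduces \<open>fr y\<close>.\<close>
  have inversion: "(\<integral>t. \<phi> t * cis (t * y) \<partial>lborel) = of_real (2 * pi) * fr y" for y
  proof -
    have "(\<lambda>k. \<integral>t. \<phi> t * (cis (t * y) * of_real (exp (- (t\<^sup>2 / (2 * (real (Suc k))\<^sup>2))))) \<partial>lborel) \<longlonglongrightarrow>
        (\<integral>t. \<phi> t * cis (t * y) \<partial>lborel)"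
    proof (rule integral_dominated_convergence)
      show "integrable lborel (\<lambda>t. norm (\<phi> t))"
        by (rule integrable_norm[OF \<phi>_int])
      show "AE t in lborel. (\<lambda>k. \<phi> t * (cis (t * y) * of_real (exp (- (t\<^sup>2 / (2 * (real (Suc k))\<^sup>2)))))) \<longlonglongrightarrow> \<phi> t * cis (t * y)"
      proof (intro AE_I2)
        fix t :: real
        have "(\<lambda>k. exp (- (t\<^sup>2 / (2 * (real (Suc k))\<^sup>2)))) \<longlonglongrightarrow> 1" by real_asymp
        then have "(\<lambda>k. \<phi> t * (cis (t * y) * of_real (exp (- (t\<^sup>2 / (2 * (real (Suc k))\<^sup>2)))))) \<longlonglongrightarrow> \<phi> t * (cis (t * y) * of_real 1)"
          by (intro tendsto_mult tendsto_const tendsto_of_real)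
        then show "(\<lambda>k. \<phi> t * (cis (t * y) * of_real (exp (- (t\<^sup>2 / (2 * (real (Suc k))\<^sup>2)))))) \<longlonglongrightarrow> \<phi> t * cis (t * y)"
          by simp
      qed
      show "AE t in lborel. norm (\<phi> t * (cis (t * y) * of_real (exp (- (t\<^sup>2 / (2 * (real (Suc k))\<^sup>2)))))) \<le> norm (\<phi> t)" for k
        by (intro AE_I2) (simp add: norm_mult mult_left_le)
    qed measurable
    moreover have "(\<lambda>k. of_real (2 * pi) * (\<integral>x. fr x * of_real (normal_density 0 (1 / real (Suc k)) (y - x)) \<partial>lborel)) \<longlonglongrightarrow>
        of_real (2 * pi) * fr y"
    proof (intro tendsto_mult_left tendsto_gauss_average)
      show "continuous_on UNIV fr"
        unfolding fr_def by (intro continuous_on_compose2[OF holomorphic_on_imp_continuous_on[OF hol]] continuous_intros) auto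
      show "norm (fr x) \<le> C * exp (A * \<bar>x\<bar>)" for x
        using growth[of "of_real x"] by (simp add: fr_def)
    qed (use A in auto)
    ultimately show ?thesis
      unfolding weighted[OF of_nat_0_less_iff[THEN iffD2, OF zero_less_Suc]] by (rule LIMSEQ_unique)
  qed
  define G where "G = (\<lambda>z. \<integral>t. \<phi> t * exp (\<i> * of_real t * z) \<partial>lborel)"
  have "G holomorphic_on UNIV"
    unfolding G_def
  proof (rule entire_integral_exp[OF \<phi>_int])
    show "\<phi> t = 0" if "\<bar>t\<bar> > A" for t
      using that by (intro supp) auto
  qed (use A in simp)
  have G: "G z - of_real (2 * pi) * f z = 0" for z
  proof (rule analytic_continuation[where f = "\<lambda>z. G z - of_real (2 * pi) * f z" and S = UNIV and U = \<real> and \<xi> = 0])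
    show "(\<lambda>z. G z - of_real (2 * pi) * f z) holomorphic_on UNIV"
      by (intro holomorphic_intros hol \<open>G holomorphic_on UNIV\<close>)
    show "(0 :: complex) islimpt \<real>"
      unfolding islimpt_approachable
    proof safe
      fix e :: real assume "e > 0"
      then show "\<exists>x'\<in>\<real>. x' \<noteq> (0 :: complex) \<and> dist x' 0 < e"
        by (intro bexI[of _ "of_real (e / 2)"]) auto
    qed
    show "G z - of_real (2 * pi) * f z = 0" if "z \<in> \<real>" for z
    proof -
      obtain y where "z = of_real y" using \<open>z \<in> \<real>\<close> by (rule Reals_cases)
      then show ?thesis
        using inversion[of y] by (simp add: G_def fr_def cis_conv_exp mult.assoc)
    qed
  qed auto
  show ?thesis
  proof (rule that[of "\<lambda>t. \<phi> t / of_real (2 * pi)"])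
    show "integrable lborel (\<lambda>t. (norm (\<phi> t / of_real (2 * pi)))\<^sup>2)"
      using \<phi>_L2 unfolding norm_divide power_divide by (intro integrable_divide_zero) simp
    show "f z = (\<integral>t. \<phi> t / of_real (2 * pi) * exp (\<i> * of_real t * z) \<partial>lborel)" for z
      using G[of z] by (simp add: G_def field_simps)
  qed (use supp in auto)
qed

section \<open>Transfer to Lebesgue measure on the interval and to bicomplex functions\<close>

corollary Paley_Wiener_lebesgue_on:
  fixes f :: "complex \<Rightarrow> complex" and A C :: real
  assumes hol: "f holomorphic_on UNIV"
    and growth: "\<And>z. norm (f z) \<le> C * exp (A * norm z)"
    and A: "A > 0" and L2: "(\<integral>\<^sup>+x. ennreal ((norm (f (of_real x)))\<^sup>2) \<partial>lebesgue) < \<infinity>"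
  obtains \<phi> where "square_integrable (ereal (- A)) (ereal A) \<phi>"
    "\<And>z. f z = integral\<^sup>L (lebesgue_on (einterval (ereal (- A)) (ereal A))) (\<lambda>t. \<phi> t * exp (\<i> * of_real t * z))"
proof -
  have [measurable]: "f \<in> borel_measurable borel"
    by (intro borel_measurable_continuous_onI holomorphic_on_imp_continuous_on hol)
  \<comment> \<open>The Fourier argument runs over \<open>lborel\<close>, the definitions over its
    completion; for Borel integrands such as this one the integrals agree.\<close>
  have L2': "integrable lborel (\<lambda>x. (norm (f (of_real x)))\<^sup>2)"
    using L2 by (intro integrableI_bounded) (auto simp: nn_integral_completion)
  obtain \<phi> :: "real \<Rightarrow> complex" where [measurable]: "\<phi> \<in> borel_measurable borel"
    and \<phi>: "integrable lborel (\<lambda>t. (norm (\<phi> t))\<^sup>2)" "\<And>t. t \<notin> {-A<..<A} \<Longrightarrow> \<phi> t = 0"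
      "\<And>z. f z = (\<integral>t. \<phi> t * exp (\<i> * of_real t * z) \<partial>lborel)"
    using Paley_Wiener[OF hol growth A L2'] by blast
  have S: "einterval (ereal (- A)) (ereal A) = {-A<..<A}"
    by (auto simp: einterval_def)
  show ?thesis
  proof (rule that[of \<phi>])
    have "\<phi> \<in> borel_measurable (lebesgue_on {-A<..<A})"
      by (intro measurable_restrict_space1 measurable_completion) measurable
    moreover have "integrable (lebesgue_on {-A<..<A}) (\<lambda>t. (norm (\<phi> t))\<^sup>2)"
    proof (subst integrable_restrict_space)
      have "integrable lebesgue (\<lambda>t. (norm (\<phi> t))\<^sup>2)"
        using \<phi>(1) by (subst integrable_completion) measurable
      then show "integrable lebesgue (\<lambda>t. indicator {-A<..<A} t *\<^sub>R (norm (\<phi> t))\<^sup>2)"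
        by (intro integrable_mult_indicator) auto
    qed auto
    ultimately show "square_integrable (ereal (- A)) (ereal A) \<phi>"
      unfolding square_integrable_def S by blast
    fix z
    have "integral\<^sup>L (lebesgue_on {-A<..<A}) (\<lambda>t. \<phi> t * exp (\<i> * of_real t * z)) =
        (\<integral>t. indicator {-A<..<A} t *\<^sub>R (\<phi> t * exp (\<i> * of_real t * z)) \<partial>lebesgue)"
      by (intro integral_restrict_space) auto
    also have "\<dots> = (\<integral>t. \<phi> t * exp (\<i> * of_real t * z) \<partial>lebesgue)"
      using \<phi>(2) by (intro Bochner_Integration.integral_cong) (auto simp: indicator_def)
    also have "\<dots> = f z"
      unfolding \<phi>(3) by (intro integral_completion) measurable
    finally show "f z = integral\<^sup>L (lebesgue_on (einterval (ereal (- A)) (ereal A))) (\<lambda>t. \<phi> t * exp (\<i> * of_real t * z))"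
      unfolding S by simp
  qed
qed

theorem theorem3p2:
  fixes A :: real and F :: "bicomplex \<Rightarrow> bicomplex"
  assumes "A > 0"
    and "bc_entire F"
    and "\<exists>C\<in>hyperbolic. \<forall>Z. hyp_le (hyp_norm (F Z)) (C * bc_exp (of_real A * hyp_norm Z))"
    and "hyp_finite (hyp_nn_integral (-\<infinity>) \<infinity> (\<lambda>X. (hyp_norm (F X))\<^sup>2))"
  shows "\<exists>\<FF>\<in>hyp_L2 (ereal (- A)) (ereal A).
           \<forall>Z. F Z = hyp_integral (ereal (- A)) (ereal A) (\<lambda>t. \<FF> t * bc_exp (bc_i * t * Z))"
proof -
  obtain F1 F2 where hol: "F1 holomorphic_on UNIV" "F2 holomorphic_on UNIV"
    and F: "\<And>a b. F (idem_comb a b) = idem_comb (F1 a) (F2 b)"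
    using assms(2) unfolding bc_entire_iff by blast
  obtain C where "C \<in> hyperbolic"
    and C: "\<And>Z. hyp_le (hyp_norm (F Z)) (C * bc_exp (of_real A * hyp_norm Z))"
    using assms(3) by blast
  then obtain c1 c2 :: real where c: "C = idem_comb (of_real c1) (of_real c2)"
    unfolding hyperbolic_iff by blast
  \<comment> \<open>A hyperbolic \<open>C\<close> has real idempotent components, and
    \<open>bc_exp\<close> and \<open>hyp_norm\<close> act componentwise, so the hyperbolic
    inequality splits into two scalar growth bounds, each with its own constant.\<close>
  have growth: "norm (F1 a) \<le> c1 * exp (A * norm a) \<and> norm (F2 b) \<le> c2 * exp (A * norm b)" for a b
  proof -
    let ?X = "hyp_norm (F (idem_comb a b))" and ?Y = "C * bc_exp (of_real A * hyp_norm (idem_comb a b))"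
    obtain s1 s2 t1 t2 :: real where "?X = idem_comb (of_real s1) (of_real s2)"
      "?Y = idem_comb (of_real t1) (of_real t2)" and le: "s1 \<le> t1" "s2 \<le> t2"
      using C[of "idem_comb a b"] unfolding hyp_le_def by blast
    then have eqs: "idem1 ?X = of_real s1" "idem2 ?X = of_real s2" "idem1 ?Y = of_real t1" "idem2 ?Y = of_real t2"
      by simp_all
    have "idem1 ?Y = of_real (c1 * exp (A * norm a))" "idem2 ?Y = of_real (c2 * exp (A * norm b))"
      by (simp_all add: c bc_exp_def hyp_norm_def exp_of_real flip: of_real_mult)
    moreover have "idem1 ?X = of_real (norm (F1 a))" "idem2 ?X = of_real (norm (F2 b))"
      by (simp_all add: hyp_norm_def F)
    ultimately show ?thesis
      using eqs le by (simp only: of_real_eq_iff)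
  qed
  have L2: "(\<integral>\<^sup>+x. ennreal ((norm (F1 (of_real x)))\<^sup>2) \<partial>lebesgue) < \<infinity>"
    "(\<integral>\<^sup>+x. ennreal ((norm (F2 (of_real x)))\<^sup>2) \<partial>lebesgue) < \<infinity>"
    using assms(4) unfolding hyp_finite_def hyp_nn_integral_norm_square[of F F1 F2, OF F] by simp_all
  obtain \<phi>1 where \<phi>1: "square_integrable (ereal (- A)) (ereal A) \<phi>1"
    "\<And>z. F1 z = integral\<^sup>L (lebesgue_on (einterval (ereal (- A)) (ereal A))) (\<lambda>t. \<phi>1 t * exp (\<i> * of_real t * z))"
    using Paley_Wiener_lebesgue_on[OF hol(1) conjunct1[OF growth] assms(1) L2(1)] by blast
  obtain \<phi>2 where \<phi>2: "square_integrable (ereal (- A)) (ereal A) \<phi>2"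
    "\<And>z. F2 z = integral\<^sup>L (lebesgue_on (einterval (ereal (- A)) (ereal A))) (\<lambda>t. \<phi>2 t * exp (\<i> * of_real t * z))"
    using Paley_Wiener_lebesgue_on[OF hol(2) conjunct2[OF growth] assms(1) L2(2)] by blast
  \<comment> \<open>The real parts recover s1 and s2 from a hyperbolic argument and extend the
    function to all bicomplex numbers. With this choice \<open>part1 \<FF>\<close> and
    \<open>part2 \<FF>\<close> equal \<phi>1 and \<phi>2 on the whole real line, so they can be
    rewritten as functions.\<close>
  define \<FF> where "\<FF> = (\<lambda>Z. idem_comb (\<phi>1 (Re (idem1 Z))) (\<phi>2 (Re (idem2 Z))))"
  have parts: "part1 \<FF> = \<phi>1" "part2 \<FF> = \<phi>2"
    by (simp_all add: fun_eq_iff part1_def part2_def \<FF>_def)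
  have "product_type_on (ereal (- A)) (ereal A) \<FF>"
    unfolding product_type_on_def
    by (intro exI[of _ \<phi>1] exI[of _ \<phi>2]) (simp add: \<FF>_def)
  then have "\<FF> \<in> hyp_L2 (ereal (- A)) (ereal A)"
    using \<phi>1(1) \<phi>2(1) by (simp add: hyp_L2_def parts)
  moreover have "F Z = hyp_integral (ereal (- A)) (ereal A) (\<lambda>t. \<FF> t * bc_exp (bc_i * t * Z))" for Z
    using F[of "idem1 Z" "idem2 Z"]
    unfolding hyp_integral_exp parts \<phi>1(2)[symmetric] \<phi>2(2)[symmetric] by simp
  ultimately show ?thesis by blast
qed

end
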